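(* If $n \geq 3$, then any action of $\mathrm{Aut}(F_n)$ on the circle by homeomorphisms factors through $\det \colon \mathrm{Aut}(F_n) \to \mathbb{Z}/2$; that is, every homomorphism $\mathrm{Aut}(F_n) \to \mathrm{Homeo}(S^1)$ factors through $\det$.
   Context: $F_n$ denotes the free group of rank $n$ and $\mathrm{Aut}(F_n)$ its automorphism group. $\mathrm{Homeo}(S^1)$ is the group of all homeomorphisms of the circle $S^1$ (not necessarily orientation-preserving). The map $\det \colon \mathrm{Aut}(F_n) \to \mathbb{Z}/2$ is the composition of the natural map $\mathrm{Aut}(F_n) \to \mathrm{GL}(n,\mathbb{Z})$, given by the action on the abelianization $\mathbb{Z}^n$ of $F_n$, with the determinant map $\mathrm{GL}(n,\mathbb{Z}) \to \{\pm 1\} \cong \mathbb{Z}/2$. *)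

theory Defs
  imports
    "HOL-Algebra.Algebra"
    "HOL-Analysis.Elementary_Metric_Spaces"
    "Jordan_Normal_Form.Determinant"
begin

section \<open>The free group of rank n\<close>

text \<open>The letter \<open>(i, True)\<close> stands for the generator \<open>x\<^sub>i\<close> and \<open>(i, False)\<close> for its inverse. The
  elements of the free group are the reduced words in the letters with index below \<open>n\<close>.\<close>

type_synonym letter = "nat \<times> bool"

definition letter_inv :: "letter \<Rightarrow> letter" where
  "letter_inv x = (fst x, \<not> snd x)"

definition reduced :: "letter list \<Rightarrow> bool" where
  "reduced w \<longleftrightarrow> successively (\<lambda>x y. y \<noteq> letter_inv x) w"

text \<open>Left multiplication of a reduced word by a single letter, with cancellation.\<close>

fun push :: "letter \<Rightarrow> letter list \<Rightarrow> letter list" where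
  "push x [] = [x]"
| "push x (y # w) = (if y = letter_inv x then w else x # y # w)"

definition free_group :: "nat \<Rightarrow> letter list monoid" where
  "free_group n =
    \<lparr>carrier = {w. reduced w \<and> set w \<subseteq> {..<n} \<times> UNIV},
     monoid.mult = (\<lambda>u v. foldr push u v),
     one = []\<rparr>"

abbreviation gen :: "nat \<Rightarrow> letter list" where
  "gen i \<equiv> [(i, True)]"

section \<open>The determinant of an automorphism\<close>

text \<open>\<open>abelianize n w\<close> is the vector of exponent sums of \<open>w\<close>. The lemmas \<open>abelianize_epi\<close> and
  \<open>kernel_abelianize\<close> below show that it is a surjection onto the integer vectors of dimension \<open>n\<close>
  whose kernel is the commutator subgroup, so it identifies the abelianization of the free group
  with them.\<close>

definition exp_sum :: "nat \<Rightarrow> letter list \<Rightarrow> int" where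
  "exp_sum i w = int (count_list w (i, True)) - int (count_list w (i, False))"

definition abelianize :: "nat \<Rightarrow> letter list \<Rightarrow> int vec" where
  "abelianize n w = vec n (\<lambda>i. exp_sum i w)"

text \<open>The matrix of the induced action on the abelianization (see \<open>aut_matrix_abelianize\<close>):
  its \<open>j\<close>-th column is the class of the image of \<open>x\<^sub>j\<close>.\<close>

definition aut_matrix :: "nat \<Rightarrow> (letter list \<Rightarrow> letter list) \<Rightarrow> int mat" where
  "aut_matrix n \<phi> = mat n n (\<lambda>(i, j). abelianize n (\<phi> (gen j)) $ i)"

text \<open>By \<open>aut_det_hom\<close> this is a homomorphism to the group \<open>sign_img\<close>, which is \<open>{1, -1}\<close>
  under multiplication, and so cyclic of order two.\<close>

definition aut_det :: "nat \<Rightarrow> (letter list \<Rightarrow> letter list) \<Rightarrow> int" where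
  "aut_det n \<phi> = Determinant.det (aut_matrix n \<phi>)"

section \<open>Homeomorphism groups\<close>

text \<open>As in \<open>BijGroup\<close>, functions are \<open>undefined\<close> outside \<open>S\<close>, so that each self-homeomorphism of
  \<open>S\<close> is represented exactly once.\<close>

definition homeo_group :: "'a::topological_space set \<Rightarrow> ('a \<Rightarrow> 'a) monoid" where
  "homeo_group S = BijGroup S \<lparr>carrier := {f \<in> Bij S. \<exists>g. homeomorphism S S f g}\<rparr>"

definition circle :: "complex set" where
  "circle = sphere 0 1"

section \<open>Basic facts\<close>

subsection \<open>Group structure\<close>

lemma letter_inv_inv [simp]: "letter_inv (letter_inv x) = x"
  by (simp add: letter_inv_def)

lemma letter_inv_neq [simp]: "letter_inv x \<noteq> x" "x \<noteq> letter_inv x"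
  by (auto simp: letter_inv_def prod_eq_iff)

lemma letter_inv_swap: "y = letter_inv x \<longleftrightarrow> x = letter_inv y"
  by auto

lemma reduced_Nil [simp]: "reduced []"
  by (simp add: reduced_def)

lemma reduced_Cons: "reduced (x # w) \<longleftrightarrow> reduced w \<and> (w = [] \<or> hd w \<noteq> letter_inv x)"
  by (cases w) (auto simp: reduced_def)

lemma reduced_push: "reduced w \<Longrightarrow> reduced (push x w)"
  by (cases w) (auto simp: reduced_Cons)

lemma reduced_foldr_push: "reduced v \<Longrightarrow> reduced (foldr push u v)"
  by (induction u) (auto intro: reduced_push)

lemma push_inv_push: "reduced w \<Longrightarrow> push (letter_inv x) (push x w) = w"
  by (cases w rule: list.exhaust[case_product list.exhaust[of "tl w"]])
    (auto simp: reduced_Cons)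

lemma push_push_inv: "reduced w \<Longrightarrow> push x (push (letter_inv x) w) = w"
  using push_inv_push[of w "letter_inv x"] by simp

lemma push_Cons_reduced: "reduced (x # w) \<Longrightarrow> push x w = x # w"
  by (cases w) (auto simp: reduced_Cons)

lemma set_push: "set (push x w) \<subseteq> insert x (set w)"
  by (cases w) auto

lemma set_foldr_push: "set (foldr push u v) \<subseteq> set u \<union> set v"
  using set_push by (induction u) fastforce+

lemma foldr_push_push:
  assumes "reduced w"
  shows "foldr push (push x v) w = push x (foldr push v w)"
  using assms
  by (cases v) (auto simp: push_push_inv reduced_foldr_push)

lemma foldr_push_assoc:
  assumes "reduced w"
  shows "foldr push (foldr push u v) w = foldr push u (foldr push v w)"
  using assms by (induction u) (auto simp: foldr_push_push)

lemma foldr_push_rev_inv: "foldr push (rev (map letter_inv w)) w = []"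
proof -
  have "foldr push (rev (map letter_inv w)) (w @ v) = v" for v
    by (induction w) auto
  from this[of "[]"] show ?thesis by simp
qed

lemma reduced_rev_inv:
  assumes "reduced w"
  shows "reduced (rev (map letter_inv w))"
proof -
  have "(\<lambda>x y. letter_inv x \<noteq> y) = (\<lambda>x y. y \<noteq> letter_inv x)"
    by auto
  then show ?thesis
    using assms
    by (auto simp: reduced_def successively_rev successively_map elim!: successively_mono)
qed

lemma free_group_group: "group (free_group n)"
proof (rule groupI)
  fix x y assume "x \<in> carrier (free_group n)" "y \<in> carrier (free_group n)"
  then show "x \<otimes>\<^bsub>free_group n\<^esub> y \<in> carrier (free_group n)"
    using set_foldr_push[of x y] by (auto simp: free_group_def reduced_foldr_push)
next
  fix x assume x: "x \<in> carrier (free_group n)"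
  then show "\<exists>y\<in>carrier (free_group n). y \<otimes>\<^bsub>free_group n\<^esub> x = \<one>\<^bsub>free_group n\<^esub>"
    by (intro bexI[of _ "rev (map letter_inv x)"])
      (auto simp: free_group_def foldr_push_rev_inv reduced_rev_inv letter_inv_def)
qed (auto simp: free_group_def foldr_push_assoc)

lemma gen_carrier: "i < n \<Longrightarrow> gen i \<in> carrier (free_group n)"
  by (simp add: free_group_def reduced_def)

lemma Cons_free_group:
  assumes "x # w \<in> carrier (free_group n)"
  shows "w \<in> carrier (free_group n)" "[x] \<in> carrier (free_group n)" "fst x < n"
    "x # w = [x] \<otimes>\<^bsub>free_group n\<^esub> w"
  using assms by (auto simp: free_group_def reduced_Cons push_Cons_reduced)

lemma inv_gen:
  assumes "i < n"
  shows "inv\<^bsub>free_group n\<^esub> (gen i) = [(i, False)]"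
proof -
  interpret group "free_group n" by (rule free_group_group)
  show ?thesis
    using assms
    by (intro inv_equality) (auto simp: free_group_def reduced_def letter_inv_def)
qed

subsection \<open>The universal property\<close>

definition letter_val :: "('b, 'c) monoid_scheme \<Rightarrow> (nat \<Rightarrow> 'b) \<Rightarrow> letter \<Rightarrow> 'b" where
  "letter_val H f x = (if snd x then f (fst x) else inv\<^bsub>H\<^esub> f (fst x))"

definition word_val :: "('b, 'c) monoid_scheme \<Rightarrow> (nat \<Rightarrow> 'b) \<Rightarrow> letter list \<Rightarrow> 'b" where
  "word_val H f w = foldr (\<lambda>x a. letter_val H f x \<otimes>\<^bsub>H\<^esub> a) w \<one>\<^bsub>H\<^esub>"

context group
begin

lemma word_val_Cons: "word_val G f (x # w) = letter_val G f x \<otimes> word_val G f w"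
  by (simp add: word_val_def)

context
  fixes f :: "nat \<Rightarrow> 'a" and n :: nat
  assumes f: "f \<in> {..<n} \<rightarrow> carrier G"
begin

lemma letter_val_closed: "fst x < n \<Longrightarrow> letter_val G f x \<in> carrier G"
  using f by (auto simp: letter_val_def)

lemma word_val_closed: "set w \<subseteq> {..<n} \<times> UNIV \<Longrightarrow> word_val G f w \<in> carrier G"
  by (induction w) (auto simp: word_val_def letter_val_closed)

lemma letter_val_inv:
  "fst x < n \<Longrightarrow> letter_val G f x \<otimes> letter_val G f (letter_inv x) = \<one>"
  using funcset_mem[OF f, of "fst x"] by (auto simp: letter_val_def letter_inv_def)

lemma word_val_push:
  assumes "fst x < n" "set w \<subseteq> {..<n} \<times> UNIV"
  shows "word_val G f (push x w) = letter_val G f x \<otimes> word_val G f w"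
proof (cases w)
  case (Cons y v)
  show ?thesis
  proof (cases "y = letter_inv x")
    case True
    have "word_val G f v \<in> carrier G" "fst y < n"
      using assms Cons by (auto intro!: word_val_closed)
    then show ?thesis
      using Cons True assms(1) letter_val_inv[of x]
        m_assoc[of "letter_val G f x" "letter_val G f y" "word_val G f v"]
      by (simp add: word_val_Cons letter_val_closed)
  qed (simp add: Cons word_val_Cons)
qed (simp add: word_val_def)

lemma word_val_mult:
  assumes "set u \<subseteq> {..<n} \<times> UNIV" "set v \<subseteq> {..<n} \<times> UNIV"
  shows "word_val G f (foldr push u v) = word_val G f u \<otimes> word_val G f v"
  using assms
proof (induction u)
  case Nil
  then show ?case by (simp add: word_val_closed word_val_def[of _ _ "[]"])
next
  case (Cons x u)
  have "set (foldr push u v) \<subseteq> {..<n} \<times> UNIV"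
    using Cons.prems set_foldr_push[of u v] by auto
  moreover have "fst x < n"
    using Cons.prems by auto
  ultimately show ?case
    using Cons by (simp add: word_val_push word_val_Cons m_assoc letter_val_closed word_val_closed)
qed

lemma word_val_hom: "word_val G f \<in> hom (free_group n) G"
  by (rule homI) (auto simp: free_group_def word_val_closed word_val_mult)

end

lemma hom_eq_word_val:
  assumes h: "h \<in> hom (free_group n) G" and w: "w \<in> carrier (free_group n)"
  shows "h w = word_val G (\<lambda>i. h (gen i)) w"
  using w
proof (induction w)
  interpret h: group_hom "free_group n" G h
    using h free_group_group by (simp add: group_hom_def group_hom_axioms_def is_group)
  case Nil
  then show ?case
    using h.hom_one by (simp add: word_val_def free_group_def)
next
  interpret h: group_hom "free_group n" G h
    using h free_group_group by (simp add: group_hom_def group_hom_axioms_def is_group)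
  case (Cons x w)
  note x = Cons_free_group[OF Cons.prems]
  have "h [x] = letter_val G (\<lambda>i. h (gen i)) x"
    using x(3) h.hom_inv[OF gen_carrier[OF x(3)]]
    by (cases x; cases "snd x") (auto simp: letter_val_def inv_gen)
  then have "h ([x] \<otimes>\<^bsub>free_group n\<^esub> w) = word_val G (\<lambda>i. h (gen i)) (x # w)"
    using Cons.IH[OF x(1)] h.hom_mult[OF x(2,1)] by (simp add: word_val_Cons)
  then show ?case
    by (simp only: x(4)[symmetric])
qed

theorem free_group_universal:
  assumes "f \<in> {..<n} \<rightarrow> carrier G"
  shows "\<exists>!h. h \<in> hom (free_group n) G \<inter> extensional (carrier (free_group n)) \<and>
    (\<forall>i<n. h (gen i) = f i)"
proof (rule ex1I)
  let ?h = "restrict (word_val G f) (carrier (free_group n))"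
  have "?h \<in> hom (free_group n) G"
    using word_val_hom[OF assms] group.is_monoid[OF free_group_group[of n]]
    by (auto simp: hom_def monoid.m_closed)
  then show "?h \<in> hom (free_group n) G \<inter> extensional (carrier (free_group n)) \<and>
      (\<forall>i<n. ?h (gen i) = f i)"
    using funcset_mem[OF assms] by (auto simp: gen_carrier word_val_def letter_val_def)
next
  fix h
  assume h: "h \<in> hom (free_group n) G \<inter> extensional (carrier (free_group n)) \<and>
    (\<forall>i<n. h (gen i) = f i)"
  show "h = restrict (word_val G f) (carrier (free_group n))"
  proof (rule extensionalityI[of _ "carrier (free_group n)"])
    fix w assume w: "w \<in> carrier (free_group n)"
    have "word_val G (\<lambda>i. h (gen i)) w = word_val G f w" if "set w \<subseteq> {..<n} \<times> UNIV" for w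
      using that h by (induction w) (auto simp: word_val_def letter_val_def)
    then show "h w = restrict (word_val G f) (carrier (free_group n)) w"
      using hom_eq_word_val[of h n w] h w by (auto simp: free_group_def)
  qed (use h in auto)
qed

end

subsection \<open>Abelianization\<close>

lemma exp_sum_Nil [simp]: "exp_sum i [] = 0"
  by (simp add: exp_sum_def)

lemma exp_sum_Cons:
  "exp_sum i (x # w) = (if fst x = i then (if snd x then 1 else -1) else 0) + exp_sum i w"
  by (cases x) (auto simp: exp_sum_def)

lemma exp_sum_push: "exp_sum i (push x w) = exp_sum i [x] + exp_sum i w"
  by (cases w) (auto simp: exp_sum_Cons letter_inv_def)

lemma exp_sum_mult: "exp_sum i (foldr push u v) = exp_sum i u + exp_sum i v"
  by (induction u) (auto simp: exp_sum_push, auto simp: exp_sum_Cons)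

lemma abelianize_carrier [simp]: "abelianize n w \<in> carrier_vec n"
  by (simp add: abelianize_def)

lemma abelianize_hom: "abelianize n \<in> hom (free_group n) (monoid_vec TYPE(int) n)"
  by (rule homI) (auto simp: abelianize_def free_group_def monoid_vec_def exp_sum_mult)

lemma group_monoid_vec: "group (monoid_vec TYPE(int) n)"
proof (rule groupI)
  fix x assume "x \<in> carrier (monoid_vec TYPE(int) n)"
  then show "\<exists>y\<in>carrier (monoid_vec TYPE(int) n).
      y \<otimes>\<^bsub>monoid_vec TYPE(int) n\<^esub> x = \<one>\<^bsub>monoid_vec TYPE(int) n\<^esub>"
    by (intro bexI[of _ "- x"]) (auto simp: monoid_vec_def)
qed (auto simp: monoid_vec_def)

lemma abelianize_group_hom: "group_hom (free_group n) (monoid_vec TYPE(int) n) (abelianize n)"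
  by (simp add: group_hom_def group_hom_axioms_def free_group_group group_monoid_vec abelianize_hom)

lemma exp_sum_replicate: "exp_sum i (replicate k (j, b)) =
    (if i = j then (if b then int k else - int k) else 0)"
  by (induction k) (auto simp: exp_sum_Cons)

lemma abelianize_epi: "abelianize n \<in> epi (free_group n) (monoid_vec TYPE(int) n)"
proof -
  have "v \<in> abelianize n ` carrier (free_group n)" if v: "v \<in> carrier_vec n" for v
  proof -
    define pw where "pw j = replicate (nat \<bar>v $ j\<bar>) (j, v $ j \<ge> 0)" for j
    have pw: "exp_sum i (pw j) = (if i = j then v $ j else 0)" for i j
      by (simp add: pw_def exp_sum_replicate)
    define w where "w m = concat (map pw [0..<m])" for m
    have app: "exp_sum i (u @ u') = exp_sum i u + exp_sum i u'" for i u u'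
      by (simp add: exp_sum_def)
    have e: "exp_sum i (w m) = (if i < m then v $ i else 0)" for i m
      by (induction m) (auto simp: w_def app pw)
    have red: "exp_sum i (foldr push u []) = exp_sum i u" for i u
      by (simp add: exp_sum_mult)
    have "set (w n) \<subseteq> {..<n} \<times> UNIV"
      by (auto simp: w_def pw_def)
    then have "foldr push (w n) [] \<in> carrier (free_group n)"
      using set_foldr_push[of "w n" "[]"] by (auto simp: free_group_def reduced_foldr_push)
    moreover have "abelianize n (foldr push (w n) []) = v"
      using v by (intro eq_vecI) (auto simp: abelianize_def red e)
    ultimately show ?thesis by blast
  qed
  then show ?thesis
    using abelianize_hom[of n] by (auto simp: epi_def monoid_vec_def)
qed

lemma (in comm_group) word_val_exp_sum:
  assumes f: "f \<in> {..<n} \<rightarrow> carrier G" and "set w \<subseteq> {..<n} \<times> UNIV"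
  shows "word_val G f w = (\<Otimes>i\<in>{..<n}. f i [^] exp_sum i w)"
  using assms(2)
proof (induction w)
  case Nil
  have "(\<Otimes>i\<in>{..<n}. f i [^] exp_sum i []) = \<one>"
    by (intro finprod_one_eqI) simp
  then show ?case by (simp add: word_val_def)
next
  case (Cons x w)
  have fx: "f (fst x) \<in> carrier G" "fst x < n" using f Cons.prems by auto
  have "letter_val G f x = (\<Otimes>i\<in>{..<n}. if fst x = i then letter_val G f x else \<one>)"
    using fx letter_val_closed[OF f]
    by (subst finprod_singleton[of "fst x" _ "\<lambda>_. letter_val G f x"]) auto
  also have "\<dots> = (\<Otimes>i\<in>{..<n}. f i [^] exp_sum i [x])"
    using f fx by (intro finprod_cong')
      (auto simp: letter_val_def exp_sum_Cons int_pow_neg)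
  finally have "word_val G f (x # w) =
      (\<Otimes>i\<in>{..<n}. f i [^] exp_sum i [x]) \<otimes> (\<Otimes>i\<in>{..<n}. f i [^] exp_sum i w)"
    using Cons by (simp add: word_val_def)
  also have "\<dots> = (\<Otimes>i\<in>{..<n}. f i [^] exp_sum i [x] \<otimes> f i [^] exp_sum i w)"
    using f by (intro finprod_multf[symmetric]) auto
  also have "\<dots> = (\<Otimes>i\<in>{..<n}. f i [^] exp_sum i (x # w))"
    using funcset_mem[OF f]
    by (intro finprod_cong') (auto simp: int_pow_mult[symmetric] exp_sum_Cons[of _ x])
  finally show ?case .
qed

theorem kernel_abelianize:
  "kernel (free_group n) (monoid_vec TYPE(int) n) (abelianize n) =
    derived (free_group n) (carrier (free_group n))"
proof
  let ?F = "free_group n" and ?Z = "monoid_vec TYPE(int) n"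
  interpret F: group ?F by (rule free_group_group)
  interpret ab: group_hom ?F ?Z "abelianize n" by (rule abelianize_group_hom)
  interpret Z: comm_group ?Z
    by (rule group.group_comm_groupI[OF group_monoid_vec])
      (auto simp: monoid_vec_def comm_add_vec)
  let ?D = "derived ?F (carrier ?F)"
  show "?D \<subseteq> kernel ?F ?Z (abelianize n)"
  proof -
    have "abelianize n ` ?D = {\<one>\<^bsub>?Z\<^esub>}"
      using ab.derived_img[of "carrier ?F"] Z.derived_eq_singleton[of "abelianize n ` carrier ?F"]
        ab.hom_closed by blast
    then show ?thesis
      using F.derived_in_carrier[of "carrier ?F"] by (auto simp: kernel_def)
  qed
  interpret D: normal ?D ?F by (rule F.derived_self_is_normal)
  interpret Q: comm_group "?F Mod ?D" by (rule F.derived_quot_is_comm_group)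
  let ?q = "\<lambda>a. ?D #>\<^bsub>?F\<^esub> a"
  have q: "?q \<in> hom ?F (?F Mod ?D)" by (rule D.r_coset_hom_Mod)
  show "kernel ?F ?Z (abelianize n) \<subseteq> ?D"
  proof
    fix w assume w: "w \<in> kernel ?F ?Z (abelianize n)"
    then have wF: "w \<in> carrier ?F" and "abelianize n w = 0\<^sub>v n"
      by (auto simp: kernel_def monoid_vec_def)
    then have e: "exp_sum i w = 0" if "i < n" for i
      using that by (metis abelianize_def index_vec index_zero_vec(1))
    have f: "(\<lambda>i. ?q (gen i)) \<in> {..<n} \<rightarrow> carrier (?F Mod ?D)"
      using q gen_carrier[of _ n] by (auto simp: hom_def)
    have "?q w = word_val (?F Mod ?D) (\<lambda>i. ?q (gen i)) w"
      by (rule Q.hom_eq_word_val[OF q wF])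
    also have "\<dots> = (\<Otimes>\<^bsub>?F Mod ?D\<^esub>i\<in>{..<n}. ?q (gen i) [^]\<^bsub>?F Mod ?D\<^esub> exp_sum i w)"
      using wF by (intro Q.word_val_exp_sum[OF f]) (auto simp: free_group_def)
    also have "\<dots> = \<one>\<^bsub>?F Mod ?D\<^esub>"
      by (intro Q.finprod_one_eqI) (auto simp: e)
    finally have "?q w = ?D"
      by (simp add: FactGroup_def)
    then show "w \<in> ?D"
      using F.rcos_self[OF wF D.is_subgroup] by simp
  qed
qed

subsection \<open>The determinant homomorphism\<close>

lemma aut_matrix_carrier [simp]: "aut_matrix n \<phi> \<in> carrier_mat n n"
  by (simp add: aut_matrix_def)

theorem aut_matrix_abelianize:
  assumes "\<phi> \<in> hom (free_group n) (free_group n)" "w \<in> carrier (free_group n)"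
  shows "abelianize n (\<phi> w) = aut_matrix n \<phi> *\<^sub>v abelianize n w"
  using assms(2)
proof (induction w)
  let ?F = "free_group n"
  interpret p: group_hom ?F ?F \<phi>
    using assms(1) free_group_group by (simp add: group_hom_def group_hom_axioms_def)
  case Nil
  have "\<phi> [] = []"
    using p.hom_one by (simp add: free_group_def)
  then show ?case
    by (intro eq_vecI) (auto simp: abelianize_def aut_matrix_def scalar_prod_def)
next
  let ?F = "free_group n" and ?Z = "monoid_vec TYPE(int) n"
  interpret p: group_hom ?F ?F \<phi>
    using assms(1) free_group_group by (simp add: group_hom_def group_hom_axioms_def)
  case (Cons x w)
  note x = Cons_free_group[OF Cons.prems]
  have mult: "abelianize n (u \<otimes>\<^bsub>?F\<^esub> v) = abelianize n u + abelianize n v" for u v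
    by (intro eq_vecI) (auto simp: abelianize_def free_group_def exp_sum_mult)
  have inv: "abelianize n (inv\<^bsub>?F\<^esub> u) = - abelianize n u" if "u \<in> carrier ?F" for u
  proof -
    have "abelianize n (inv\<^bsub>?F\<^esub> u) + abelianize n u = abelianize n \<one>\<^bsub>?F\<^esub>"
      using that by (simp flip: mult)
    also have "\<dots> = 0\<^sub>v n"
      by (intro eq_vecI) (auto simp: abelianize_def free_group_def)
    finally show ?thesis
      by (intro eq_vecI) (auto simp: abelianize_def vec_eq_iff)
  qed
  have g: "abelianize n (\<phi> (gen j)) = aut_matrix n \<phi> *\<^sub>v abelianize n (gen j)" if "j < n" for j
  proof -
    have "abelianize n (gen j) = unit_vec n j"
      using that by (intro eq_vecI) (auto simp: abelianize_def exp_sum_Cons)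
    moreover have "aut_matrix n \<phi> *\<^sub>v unit_vec n j = col (aut_matrix n \<phi>) j"
      using that by (intro eq_vecI) (auto simp: aut_matrix_def)
    ultimately show ?thesis
      using that by (intro eq_vecI) (auto simp: aut_matrix_def abelianize_def)
  qed
  obtain j b where jb: "x = (j, b)" "j < n" using x(3) by (cases x) auto
  have "abelianize n (\<phi> [x]) = aut_matrix n \<phi> *\<^sub>v abelianize n [x]"
  proof (cases b)
    case False
    then have "[x] = inv\<^bsub>?F\<^esub> (gen j)" using jb by (simp add: inv_gen)
    then show ?thesis
      using jb gen_carrier[of j n] g[of j]
      by (simp add: inv)
        (auto intro!: eq_vecI simp: aut_matrix_def scalar_prod_def sum_negf abelianize_def)
  qed (use g jb in simp)
  then show ?case
    using x Cons.IH[OF x(1)] p.hom_mult[OF x(2,1)]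
    by (simp add: mult mult_add_distrib_mat_vec[of _ n n])
qed

lemma aut_matrix_compose:
  assumes "\<phi> \<in> auto (free_group n)" "\<psi> \<in> auto (free_group n)"
  shows "aut_matrix n (compose (carrier (free_group n)) \<phi> \<psi>) = aut_matrix n \<phi> * aut_matrix n \<psi>"
proof (rule eq_matI)
  fix i j assume "i < dim_row (aut_matrix n \<phi> * aut_matrix n \<psi>)"
    "j < dim_col (aut_matrix n \<phi> * aut_matrix n \<psi>)"
  then have ij: "i < n" "j < n" by (auto simp: aut_matrix_def)
  have \<psi>: "\<psi> (gen j) \<in> carrier (free_group n)"
    using assms(2) gen_carrier[OF ij(2)] by (auto simp: auto_def hom_def)
  have "col (aut_matrix n \<psi>) j = abelianize n (\<psi> (gen j))"
    using ij by (intro eq_vecI) (auto simp: aut_matrix_def abelianize_def)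
  moreover have "abelianize n (\<phi> (\<psi> (gen j))) = aut_matrix n \<phi> *\<^sub>v abelianize n (\<psi> (gen j))"
    using assms(1) \<psi> by (intro aut_matrix_abelianize) (auto simp: auto_def)
  ultimately show "aut_matrix n (compose (carrier (free_group n)) \<phi> \<psi>) $$ (i, j) =
      (aut_matrix n \<phi> * aut_matrix n \<psi>) $$ (i, j)"
    using ij gen_carrier[OF ij(2)]
    by (simp add: aut_matrix_def[of n "compose _ _ _"] compose_eq carrier_matD[OF aut_matrix_carrier])
qed (auto simp: aut_matrix_def)

lemma aut_matrix_one:
  "aut_matrix n (\<lambda>x\<in>carrier (free_group n). x) = 1\<^sub>m n"
  by (rule eq_matI) (auto simp: aut_matrix_def abelianize_def gen_carrier exp_sum_Cons)

lemma AutoGroup_simps: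
  "carrier (AutoGroup G) = auto G"
  "\<one>\<^bsub>AutoGroup G\<^esub> = (\<lambda>x\<in>carrier G. x)"
  "\<phi> \<in> auto G \<Longrightarrow> \<psi> \<in> auto G \<Longrightarrow> \<phi> \<otimes>\<^bsub>AutoGroup G\<^esub> \<psi> = compose (carrier G) \<phi> \<psi>"
  by (auto simp: AutoGroup_def BijGroup_def auto_def)

theorem aut_det_hom: "aut_det n \<in> hom (AutoGroup (free_group n)) sign_img"
proof -
  let ?A = "AutoGroup (free_group n)"
  interpret A: group ?A by (rule group.AutoGroup[OF free_group_group])
  have mult: "aut_det n (\<phi> \<otimes>\<^bsub>?A\<^esub> \<psi>) = aut_det n \<phi> * aut_det n \<psi>"
    if "\<phi> \<in> carrier ?A" "\<psi> \<in> carrier ?A" for \<phi> \<psi>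
    using that det_mult[OF aut_matrix_carrier aut_matrix_carrier, of n \<phi> \<psi>]
    by (simp add: AutoGroup_simps aut_det_def aut_matrix_compose)
  have "aut_det n \<phi> \<in> {-1, 1}" if \<phi>: "\<phi> \<in> carrier ?A" for \<phi>
  proof -
    have "aut_det n \<phi> * aut_det n (inv\<^bsub>?A\<^esub> \<phi>) = aut_det n \<one>\<^bsub>?A\<^esub>"
      using \<phi> by (simp flip: mult)
    also have "\<dots> = 1"
      by (simp add: AutoGroup_simps aut_det_def aut_matrix_one)
    finally show ?thesis
      by (auto simp: zmult_eq_1_iff)
  qed
  then show ?thesis
    using mult by (auto simp: hom_def sign_img_def)
qed

subsection \<open>Homeomorphism groups\<close>

theorem group_homeo_group: "group (homeo_group S)"
proof -
  interpret B: group "BijGroup S" by (rule group_BijGroup)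
  have "subgroup {f \<in> Bij S. \<exists>g. homeomorphism S S f g} (BijGroup S)"
  proof (rule B.subgroupI)
    have "(\<lambda>x\<in>S. x) \<in> Bij S \<and> homeomorphism S S (\<lambda>x\<in>S. x) (\<lambda>x\<in>S. x)"
      by (auto simp: id_Bij homeomorphism_def cong: continuous_on_cong_simp)
    then show "{f \<in> Bij S. \<exists>g. homeomorphism S S f g} \<noteq> {}"
      by blast
  next
    fix f assume "f \<in> {f \<in> Bij S. \<exists>g. homeomorphism S S f g}"
    then obtain g where f: "f \<in> Bij S" and g: "homeomorphism S S f g" by auto
    have "inv_into S f x = g x" if "x \<in> S" for x
      using f g that by (auto simp: Bij_def bij_betw_def homeomorphism_def intro!: inv_into_f_eq)
    then have "homeomorphism S S (\<lambda>x\<in>S. inv_into S f x) f"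
      using g by (auto simp: homeomorphism_def image_iff cong: continuous_on_cong)
    then show "inv\<^bsub>BijGroup S\<^esub> f \<in> {f \<in> Bij S. \<exists>g. homeomorphism S S f g}"
      using f by (auto simp: inv_BijGroup restrict_inv_into_Bij simp del: restrict_apply)
  next
    fix f f' assume "f \<in> {f \<in> Bij S. \<exists>g. homeomorphism S S f g}"
      "f' \<in> {f \<in> Bij S. \<exists>g. homeomorphism S S f g}"
    then obtain g g' where f: "f \<in> Bij S" "f' \<in> Bij S"
      and g: "homeomorphism S S f g" "homeomorphism S S f' g'" by auto
    have "homeomorphism S S (f \<circ> f') (g' \<circ> g)"
      using homeomorphism_compose[OF g(2,1)] .
    then have "homeomorphism S S (compose S f f') (g' \<circ> g)"
      by (rule homeomorphism_cong) (auto simp: compose_def)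
    then show "f \<otimes>\<^bsub>BijGroup S\<^esub> f' \<in> {f \<in> Bij S. \<exists>g. homeomorphism S S f g}"
      using f by (auto simp: BijGroup_def compose_Bij)
  qed (auto simp: BijGroup_def)
  from B.subgroup_imp_group[OF this] show ?thesis
    by (simp add: homeo_group_def)
qed

end

theory Submission
  imports Defs "HOL-Analysis.Homeomorphism"
begin

text \<open>A Klein four-group \<open>{1, a, b, ab}\<close> of circle homeomorphisms whose involutions are all conjugate
  is trivial: if the involutions are free, the orbit of a point \<open>p\<close> consists of four points, and each pair
  \<open>{p, gp}\<close> would have to separate the other two; if they have fixed points, each involution has
  exactly two and interchanges those of the others, and then \<open>b\<close> preserves and \<open>a\<close>
  interchanges the two arcs bounded by the fixed points of \<open>a\<close>, so that \<open>ab\<close> is free.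

  Such four-groups abound in the automorphism group of a free group of rank at least three. The products
  \<open>\<epsilon>\<^sub>i\<epsilon>\<^sub>j\<close> of inversions of generators form one, so they act trivially. This makes the
  action of a transvection \<open>x\<^sub>i \<mapsto> x\<^sub>i x\<^sub>j\<close> an involution that agrees with that of
  \<open>x\<^sub>i \<mapsto> x\<^sub>j x\<^sub>i\<close>. Hence \<open>x\<^sub>1 \<mapsto> x\<^sub>1 x\<^sub>2\<close> and \<open>x\<^sub>1 \<mapsto> x\<^sub>1 x\<^sub>3\<close>
  commute in the image and span another such four-group, and the transvections act trivially as well. By
  Nielsen's theorem the automorphism group is generated by transvections and signed transpositions, and the
  latter all act like one inversion. The group of order two has no such four-groups either, so the same
  argument computes the determinant of a transvection.\<close>

section \<open>Klein four-groups on the circle\<close>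

text \<open>Stereographic projection onto the line orthogonal to \<open>\<i>\<close>, which is the
  real axis. The shape of the circle enters the four-group argument only through these
  charts.\<close>

lemma circle_punctured_chart:
  assumes "p \<in> circle"
  shows "\<exists>h k. homeomorphism (circle - {p}) (UNIV :: real set) h k"
proof -
  have "circle - {p} homeomorphic {x::complex. \<i> \<bullet> x = 0}"
    using assms unfolding circle_def by (intro homeomorphic_punctured_sphere_hyperplane) auto
  also have "{x::complex. \<i> \<bullet> x = 0} homeomorphic (UNIV :: real set)"
  proof -
    have "homeomorphism {x::complex. \<i> \<bullet> x = 0} (UNIV :: real set) Re complex_of_real"
      by (rule homeomorphismI)
        (auto simp: inner_complex_def complex_eq_iff intro!: continuous_intros)
    then show ?thesis by (auto simp: homeomorphic_def)
  qed
  finally show ?thesis by (simp add: homeomorphic_def)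
qed

section \<open>Continuous involutions seen in a line chart\<close>

lemma continuous_segment_ivt:
  fixes g :: "real \<Rightarrow> real"
  assumes "continuous_on (closed_segment s t) g" "g s \<le> y" "y \<le> g t"
  shows "\<exists>x\<in>closed_segment s t. g x = y"
proof -
  have "connected (g ` closed_segment s t)"
    using assms(1) by (intro connected_continuous_image) auto
  then have "{g s..g t} \<subseteq> g ` closed_segment s t"
    by (intro connected_contains_Icc) auto
  then show ?thesis using assms by auto
qed

text \<open>A continuous injection of the line is strictly monotone, and an increasing involution is
  the identity, since \<open>x < F x\<close> would give \<open>F x < F (F x) = x\<close>.\<close>

lemma real_involution_cases:
  fixes F :: "real \<Rightarrow> real"
  assumes cont: "continuous_on UNIV F" and inv: "\<And>x. F (F x) = x"
  shows "(\<forall>x. F x = x) \<or> (\<forall>x y. x < y \<longrightarrow> F y < F x)"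
proof (rule disjCI)
  assume "\<not> (\<forall>x y. x < y \<longrightarrow> F y < F x)"
  then obtain x y where xy: "x < y" "F x \<le> F y" by (auto simp: not_less)
  have inj: "inj F" using inv by (metis injI)
  then have xy': "F x < F y" using xy by (metis injD less_le)
  have tri: "(F a < F b \<and> F b < F c) \<or> (F c < F b \<and> F b < F a)" if "a < b" "b < c" for a b c
    using that by (intro continuous_inj_imp_mono) (auto intro: continuous_on_subset[OF cont] inj_on_subset[OF inj])
  \<comment> \<open>\<open>tri\<close> compares only three points at a time; the outer points
    \<open>m\<close> and \<open>M\<close> link the given pair to an arbitrary one.\<close>
  have mono: "F s < F t" if "s < t" for s t
  proof -
    define m M where "m = min x s - 1" and "M = max y t + 1"
    have "m < x" "m < s" "y < M" "t < M" by (auto simp: m_def M_def)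
    then show ?thesis
      using tri[of m x y] tri[of x y M] tri[of m s t] tri[of s t M] tri[of m x M] tri[of m s M] xy xy' that
      by linarith
  qed
  show "\<forall>x. F x = x"
    using mono inv by (metis linorder_neqE_linordered_idom order_less_asym)
qed

text \<open>Since \<open>p\<close> is fixed, \<open>f\<close> restricts to an involution of the
  punctured space, hence of the line, where \<open>real_involution_cases\<close> leaves only the
  order-reversing case.\<close>

lemma punctured_involution_antimono:
  fixes h :: "'a::topological_space \<Rightarrow> real"
  assumes hk: "homeomorphism (S - {p}) UNIV h k" and p: "p \<in> S"
    and f: "continuous_on S f" "f \<in> S \<rightarrow> S" "\<And>x. x \<in> S \<Longrightarrow> f (f x) = x" "f p = p"
    and nid: "\<exists>x\<in>S. f x \<noteq> x"
    and xy: "x \<in> S - {p}" "y \<in> S - {p}" "h x < h y"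
  shows "h (f y) < h (f x)"
proof -
  have k: "k t \<in> S - {p}" "h (k t) = t" for t
    using hk by (auto simp: homeomorphism_def)
  have h: "k (h x) = x" if "x \<in> S - {p}" for x
    using hk that by (auto simp: homeomorphism_def)
  have fS: "f x \<in> S - {p}" if "x \<in> S - {p}" for x
    using that f p by (metis DiffD1 DiffD2 DiffI PiE insert_iff singletonD)
  let ?F = "\<lambda>t. h (f (k t))"
  have "continuous_on UNIV ?F"
  proof -
    have "continuous_on UNIV (\<lambda>t. f (k t))"
      using k by (intro continuous_on_compose2[OF f(1), of UNIV k] homeomorphism_cont2[OF hk]) auto
    then show ?thesis
      using k fS by (intro continuous_on_compose2[OF homeomorphism_cont1[OF hk]]) auto
  qed
  moreover have "?F (?F t) = t" for t
    using k[of t] fS[OF k(1), of t] h f(3) by simp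
  ultimately have "(\<forall>t. ?F t = t) \<or> (\<forall>s t. s < t \<longrightarrow> ?F t < ?F s)"
    by (rule real_involution_cases)
  moreover have "\<not> (\<forall>t. ?F t = t)"
  proof
    assume "\<forall>t. ?F t = t"
    then have "f x = x" if "x \<in> S - {p}" for x
      using that h fS by metis
    then show False using nid f(4) by (metis DiffI singletonD)
  qed
  ultimately show ?thesis using xy h by metis
qed

text \<open>If the point \<open>f p\<close> does not separate \<open>x\<close> from \<open>f x\<close> on the line obtained by puncturing at
  \<open>p\<close>, then \<open>f\<close> exchanges the ends of an interval on which it is defined in the chart.\<close>

lemma involution_fixed_point:
  fixes h :: "'a::topological_space \<Rightarrow> real"
  assumes hk: "homeomorphism (S - {p}) UNIV h k" and p: "p \<in> S"
    and f: "continuous_on S f" "f \<in> S \<rightarrow> S" "\<And>x. x \<in> S \<Longrightarrow> f (f x) = x"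
    and x: "x \<in> S - {p}" "f x \<noteq> p"
    and sep: "h (f p) \<notin> closed_segment (h x) (h (f x))"
  shows "\<exists>w\<in>S. f w = w"
proof -
  have k: "k t \<in> S - {p}" "h (k t) = t" for t
    using hk by (auto simp: homeomorphism_def)
  have h: "k (h x) = x" if "x \<in> S - {p}" for x
    using hk that by (auto simp: homeomorphism_def)
  let ?I = "closed_segment (h x) (h (f x))"
  let ?F = "\<lambda>t. h (f (k t))"
  \<comment> \<open>\<open>f (k t) = p\<close> would mean \<open>t = h (f p)\<close>, which
    \<open>sep\<close> keeps out of the segment.\<close>
  have fk: "f (k t) \<in> S - {p}" if "t \<in> ?I" for t
    using that k[of t] f sep by force
  have "continuous_on ?I (\<lambda>t. f (k t))"
    using k by (intro continuous_on_compose2[OF f(1), of ?I k]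
        continuous_on_subset[OF homeomorphism_cont2[OF hk]]) auto
  then have cF: "continuous_on ?I ?F"
    using fk by (intro continuous_on_compose2[OF homeomorphism_cont1[OF hk]]) auto
  have fx: "f x \<in> S - {p}" using x f by auto
  have ends: "?F (h x) = h (f x)" "?F (h (f x)) = h x"
    using x fx h f by auto
  \<comment> \<open>\<open>?F\<close> interchanges the ends of the segment, so
    \<open>?F t - t\<close> takes opposite values there.\<close>
  have "\<exists>t\<in>?I. ?F t - t = 0"
  proof (cases "h x \<le> h (f x)")
    case True
    have "\<exists>t\<in>closed_segment (h (f x)) (h x). ?F t - t = 0"
      using cF True ends by (intro continuous_segment_ivt) (auto intro!: continuous_intros simp: closed_segment_commute)
    then show ?thesis by (simp add: closed_segment_commute)
  next
    case False
    then show ?thesis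
      using cF ends by (intro continuous_segment_ivt) (auto intro!: continuous_intros)
  qed
  then obtain t where t: "t \<in> ?I" "?F t = t" by auto
  then have "f (k t) = k t" using h fk by metis
  then show ?thesis using k by blast
qed

text \<open>The maps \<open>u\<close> and \<open>v\<close> make \<open>a\<close>, \<open>b\<close>
  and \<open>ab\<close> conjugate. They only transport fixed points and nontriviality between the
  three involutions, so bijections suffice as conjugators.\<close>

lemma klein_four_action_trivial:
  fixes S :: "'a::topological_space set"
  assumes chart: "\<And>p. p \<in> S \<Longrightarrow> \<exists>h k. homeomorphism (S - {p}) (UNIV :: real set) h k"
    and cont: "continuous_on S a" "continuous_on S b"
    and S: "a \<in> S \<rightarrow> S" "b \<in> S \<rightarrow> S"
    and invol: "\<And>x. x \<in> S \<Longrightarrow> a (a x) = x" "\<And>x. x \<in> S \<Longrightarrow> b (b x) = x"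
    and comm: "\<And>x. x \<in> S \<Longrightarrow> a (b x) = b (a x)"
    and uv: "bij_betw u S S" "bij_betw v S S"
    and conj: "\<And>x. x \<in> S \<Longrightarrow> u (a x) = b (u x)" "\<And>x. x \<in> S \<Longrightarrow> v (a x) = a (b (v x))"
    and x: "x \<in> S"
  shows "a x = x"
proof (rule ccontr)
  assume nx: "a x \<noteq> x"
  define c where "c = (\<lambda>x. a (b x))"
  have [simp]: "a y \<in> S" "b y \<in> S" "c y \<in> S" if "y \<in> S" for y
    using S that by (auto simp: c_def)
  have uvS: "u y \<in> S" "v y \<in> S" if "y \<in> S" for y
    using uv that by (auto simp: bij_betw_def)
  have ccont: "continuous_on S c"
    unfolding c_def using S by (intro continuous_on_compose2[OF cont(1) cont(2)]) auto
  have cinvol: "c (c y) = y" if "y \<in> S" for y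
    using that by (simp add: c_def comm invol)
  have cv: "v (a y) = c (v y)" if "y \<in> S" for y
    using conj(2) that by (simp add: c_def)
  \<comment> \<open>With \<open>f\<close> being first \<open>b\<close> and then \<open>c\<close>:
    the bijection \<open>w\<close> carries the fixed points of \<open>a\<close> onto those of
    \<open>f\<close>.\<close>
  have trans: "(\<exists>y\<in>S. a y = y) \<longleftrightarrow> (\<exists>y\<in>S. f y = y)" "\<exists>y\<in>S. f y \<noteq> y"
    if w: "bij_betw w S S" "\<And>y. y \<in> S \<Longrightarrow> w (a y) = f (w y)" for w f
  proof -
    have eq: "a y = y \<longleftrightarrow> f (w y) = w y" if "y \<in> S" for y
      using w that bij_betw_imp_inj_on[OF w(1)] by (metis \<open>\<And>y. y \<in> S \<Longrightarrow> a y \<in> S\<close> inj_on_eq_iff)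
    have im: "w ` S = S" using w(1) by (rule bij_betw_imp_surj_on)
    show "(\<exists>y\<in>S. a y = y) \<longleftrightarrow> (\<exists>y\<in>S. f y = y)"
      using eq im by (metis image_iff)
    show "\<exists>y\<in>S. f y \<noteq> y"
      using eq[OF x] im x nx by blast
  qed
  note tb = trans[OF uv(1) conj(1)] and tc = trans[OF uv(2) cv]
  show False
  proof (cases "\<exists>p\<in>S. a p = p")
    case False
    obtain h k where hk: "homeomorphism (S - {x}) (UNIV :: real set) h k" using chart[OF x] by auto
    have free: "a y \<noteq> y" "b y \<noteq> y" "c y \<noteq> y" if "y \<in> S" for y
      using that False tb tc by auto
    have ne: "a x \<in> S - {x}" "b x \<in> S - {x}" "c x \<in> S - {x}"
      using x free by auto
    have hinj: "inj_on h (S - {x})"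
      using hk by (metis homeomorphism_def inj_on_inverseI)
    have "a x \<noteq> b x"
      using free(3)[OF x] x invol by (metis c_def)
    then have "h (a x) \<noteq> h (b x)" using ne hinj by (auto dest: inj_onD)
    \<comment> \<open>As \<open>a\<close> is free, \<open>involution_fixed_point\<close> forces
      \<open>a x\<close> to separate \<open>b x\<close> from \<open>a (b x) = c x\<close>. With the
      symmetric statement for \<open>b\<close>, each of \<open>a x\<close> and \<open>b x\<close>
      lies between the other and \<open>c x\<close>, so they would be equal.\<close>
    moreover have "h (a x) \<in> closed_segment (h (b x)) (h (a (b x)))"
      using involution_fixed_point[OF hk x cont(1) S(1) invol(1), of "b x"] ne free x
      by (auto simp: c_def)
    moreover have "h (b x) \<in> closed_segment (h (a x)) (h (b (a x)))"
      using involution_fixed_point[OF hk x cont(2) S(2) invol(2), of "a x"] ne free x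
      by (auto simp: c_def comm)
    ultimately show False
      using comm[OF x] by (auto simp: closed_segment_eq_real_ivl split: if_splits)
  next
    case True
    then obtain p where p: "p \<in> S" "a p = p" by auto
    obtain h k where hk: "homeomorphism (S - {p}) (UNIV :: real set) h k" using chart[OF p(1)] by auto
    have k: "k t \<in> S - {p}" "h (k t) = t" for t
      using hk by (auto simp: homeomorphism_def)
    have kh: "k (h y) = y" if "y \<in> S - {p}" for y
      using hk that by (auto simp: homeomorphism_def)
    have anti_a: "h (a z) < h (a y)" if "y \<in> S - {p}" "z \<in> S - {p}" "h y < h z" for y z
      using punctured_involution_antimono[OF hk p(1) cont(1) S(1) invol(1) p(2)] x nx that by blast
    have aS: "a y \<in> S - {p}" if "y \<in> S - {p}" for y
      using that p invol by (metis DiffD1 DiffD2 DiffI \<open>\<And>y. y \<in> S \<Longrightarrow> a y \<in> S\<close> singletonD singletonI)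
    \<comment> \<open>\<open>b\<close> commutes with \<open>a\<close> and so permutes the fixed
      points of \<open>a\<close>; \<open>q\<close> turns out to be a second one.\<close>
    define q where "q = b p"
    \<comment> \<open>If \<open>b\<close> fixed \<open>p\<close> as well, then \<open>a\<close> and
      \<open>b\<close> would both reverse the line and \<open>c\<close> would preserve its order;
      but \<open>c\<close> is a nontrivial involution that would fix \<open>p\<close> too.\<close>
    have "q \<noteq> p"
    proof
      assume "q = p"
      then have bp: "b p = p" "c p = p" using p by (auto simp: q_def c_def)
      have bS: "b y \<in> S - {p}" if "y \<in> S - {p}" for y
        using that bp p invol by (metis DiffD1 DiffD2 DiffI \<open>\<And>y. y \<in> S \<Longrightarrow> b y \<in> S\<close> singletonD singletonI)
      have "h (b (k 1)) < h (b (k 0))"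
        using punctured_involution_antimono[OF hk p(1) cont(2) S(2) invol(2) bp(1) tb(2)] k by auto
      then have "h (c (k 0)) < h (c (k 1))"
        using anti_a bS k by (auto simp: c_def)
      moreover have "c \<in> S \<rightarrow> S" by simp
      ultimately show False
        using punctured_involution_antimono[OF hk p(1) ccont _ cinvol bp(2) tc(2) k(1)[of 0] k(1)[of 1]] k
        by simp
    qed
    then have q: "q \<in> S - {p}" "a q = q" "b q = p"
      using p comm[OF p(1)] invol by (auto simp: q_def)
    obtain r where r: "r \<in> S" "b r = r" using tb True by auto
    obtain w where w: "w \<in> S" "c w = w" using tc True by auto
    have rpq: "r \<in> S - {p}" "r \<noteq> q" using r q p \<open>q \<noteq> p\<close> by (auto simp: q_def)
    have wpq: "w \<in> S - {p}" "w \<noteq> q"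
      using w q p by (auto simp: c_def q_def)
    have hne: "h y \<noteq> h q" if "y \<in> S - {p}" "y \<noteq> q" for y
      using that q kh by metis
    have bS: "b y \<in> S - {p} \<and> b y \<noteq> q" if "y \<in> S - {p}" "y \<noteq> q" for y
      using that p q invol(2)[of y] by (auto simp: q_def)
    \<comment> \<open>Reversing the order around the fixed point \<open>q\<close>, \<open>a\<close>
      interchanges the two arcs between \<open>p\<close> and \<open>q\<close>.\<close>
    have side_a: "h (a y) < h q \<longleftrightarrow> h q < h y" if "y \<in> S - {p}" "y \<noteq> q" for y
      using anti_a[of y q] anti_a[of q y] hne[OF that] that q by force
    have ar: "b (a r) = a r" "a r \<in> S - {p}" "a r \<noteq> q"
      using comm[OF r(1)] r aS[OF rpq(1)] rpq q invol(1)[OF r(1)] by auto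
    \<comment> \<open>\<open>b\<close> sends \<open>q\<close> to the puncture \<open>p\<close>, so
      in the chart it is continuous only away from \<open>h q\<close>.\<close>
    have cb: "continuous_on I (\<lambda>t. h (b (k t)))" if "h q \<notin> I" for I
    proof -
      have "continuous_on I (\<lambda>t. b (k t))"
        using k by (intro continuous_on_compose2[OF cont(2), of I k]
            continuous_on_subset[OF homeomorphism_cont2[OF hk]]) auto
      moreover have "b (k t) \<in> S - {p}" if "t \<in> I" for t
        using that bS[OF k(1)[of t]] k(2)[of t] \<open>h q \<notin> I\<close> by metis
      ultimately show ?thesis
        by (intro continuous_on_compose2[OF homeomorphism_cont1[OF hk]]) auto
    qed
    have side_b: "h (b y) < h q \<longleftrightarrow> h y < h q" if y: "y \<in> S - {p}" "y \<noteq> q" for y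
    proof -
      \<comment> \<open>The fixed points \<open>r\<close> and \<open>a r\<close> of \<open>b\<close>
        lie on opposite sides of \<open>q\<close>; \<open>r'\<close> is the one on the side of
        \<open>y\<close>. Along the segment from \<open>y\<close> to \<open>r'\<close> the image
        under \<open>b\<close> cannot cross \<open>q\<close>, because only \<open>p\<close> is sent
        to \<open>q\<close>.\<close>
      obtain r' where r': "r' \<in> S - {p}" "r' \<noteq> q" "b r' = r'" "h r' < h q \<longleftrightarrow> h y < h q"
        using side_a[OF rpq] ar rpq r hne[OF rpq] by (metis linorder_neqE_linordered_idom order_less_asym)
      let ?I = "closed_segment (h y) (h r')" and ?g = "\<lambda>t. h (b (k t))"
      have nI: "h q \<notin> ?I" "h q \<notin> closed_segment (h r') (h y)"
        using r' hne[OF y] hne[OF r'(1,2)] by (auto simp: closed_segment_eq_real_ivl split: if_splits)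
      have g: "?g t \<noteq> h q" if "t \<in> ?I" for t
        using that nI(1) bS[OF k(1)[of t]] k(2)[of t] hne by metis
      have ends: "?g (h y) = h (b y)" "?g (h r') = h r'"
        using kh y r' by auto
      have "\<not> (h (b y) \<le> h q \<and> h q \<le> h r')"
        using continuous_segment_ivt[OF cb[OF nI(1)], of "h q"] g ends by auto
      moreover have "\<not> (h r' \<le> h q \<and> h q \<le> h (b y))"
        using continuous_segment_ivt[OF cb[OF nI(2)], of "h q"] g ends
        by (auto simp: closed_segment_commute)
      ultimately show ?thesis using r' by linarith
    qed
    \<comment> \<open>At a fixed point of \<open>c\<close> the maps \<open>a\<close> and
      \<open>b\<close> agree, yet \<open>a\<close> changes arcs and \<open>b\<close> does
      not.\<close>
    have "b w = a w" using w invol(1)[of "b w"] by (auto simp: c_def)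
    then show False
      using side_a[OF wpq] side_b[OF wpq] hne[OF wpq] by auto
  qed
qed

section \<open>Elementary automorphisms\<close>

abbreviation word_inv :: "letter list \<Rightarrow> letter list" where
  "word_inv w \<equiv> rev (map letter_inv w)"

abbreviation wmult :: "letter list \<Rightarrow> letter list \<Rightarrow> letter list" (infixr "\<star>" 70) where
  "u \<star> v \<equiv> foldr push u v"

lemma letter_inv_eq_iff [simp]: "letter_inv x = letter_inv y \<longleftrightarrow> x = y"
  by (metis letter_inv_inv)

lemma fst_letter_inv [simp]: "fst (letter_inv x) = fst x"
  by (simp add: letter_inv_def)

lemma fst_eq_letter_iff: "fst x = fst y \<longleftrightarrow> x = y \<or> x = letter_inv y"
  by (cases x; cases y) (auto simp: letter_inv_def)

lemma letter_neq:
  assumes "fst x \<noteq> fst y"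
  shows "x \<noteq> y" "y \<noteq> x" "letter_inv x \<noteq> y" "x \<noteq> letter_inv y" "letter_inv y \<noteq> x" "y \<noteq> letter_inv x"
  using assms by auto

lemma word_inv_inv [simp]: "word_inv (word_inv w) = w"
  by (simp add: rev_map comp_def)

lemma free_group_simps:
  "w \<in> carrier (free_group n) \<longleftrightarrow> reduced w \<and> set w \<subseteq> {..<n} \<times> UNIV"
  "u \<otimes>\<^bsub>free_group n\<^esub> v = u \<star> v" "\<one>\<^bsub>free_group n\<^esub> = []"
  by (auto simp: free_group_def)

lemma letter_carrier: "[x] \<in> carrier (free_group n) \<longleftrightarrow> fst x < n"
  by (cases x) (simp add: free_group_simps reduced_Cons)

lemma word_inv_carrier:
  "w \<in> carrier (free_group n) \<Longrightarrow> word_inv w \<in> carrier (free_group n)"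
  by (auto simp: free_group_simps reduced_rev_inv letter_inv_def)

lemma inv_free_group:
  assumes "w \<in> carrier (free_group n)"
  shows "inv\<^bsub>free_group n\<^esub> w = word_inv w"
proof -
  interpret group "free_group n" by (rule free_group_group)
  show ?thesis
    using assms word_inv_carrier
    by (intro inv_equality) (auto simp: free_group_simps foldr_push_rev_inv)
qed

section \<open>Endomorphisms given by substituting words for letters\<close>

definition subst_word :: "(letter \<Rightarrow> letter list) \<Rightarrow> letter list \<Rightarrow> letter list" where
  "subst_word f w = foldr (\<lambda>x v. f x \<star> v) w []"

definition subst_aut :: "nat \<Rightarrow> (letter \<Rightarrow> letter list) \<Rightarrow> letter list \<Rightarrow> letter list" where
  "subst_aut n f = restrict (subst_word f) (carrier (free_group n))"

text \<open>Images of inverse letters are prescribed too, so that a generator and its inverse can be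
  treated alike; this is the consistency under which such a table defines an endomorphism.\<close>

definition letter_map :: "nat \<Rightarrow> (letter \<Rightarrow> letter list) \<Rightarrow> bool" where
  "letter_map n f \<longleftrightarrow> (\<forall>x. fst x < n \<longrightarrow>
    f x \<in> carrier (free_group n) \<and> f (letter_inv x) = word_inv (f x))"

lemma letter_mapD:
  assumes "letter_map n f" "fst x < n"
  shows "f x \<in> carrier (free_group n)" "f (letter_inv x) = word_inv (f x)"
  using assms unfolding letter_map_def by blast+

lemma letter_mapI:
  assumes "\<And>x. fst x < n \<Longrightarrow> f x \<in> carrier (free_group n)"
    and "\<And>x. fst x < n \<Longrightarrow> f (letter_inv x) = word_inv (f x)"
  shows "letter_map n f"
  using assms unfolding letter_map_def by blast

lemma subst_word_simps [simp]: "subst_word f [] = []" "subst_word f (x # w) = f x \<star> subst_word f w"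
  by (simp_all add: subst_word_def)

lemma wmult_Nil_right:
  assumes "reduced w" shows "w \<star> [] = w"
  using assms by (induction w) (auto simp: reduced_Cons push_Cons_reduced)

lemma wmult_Nil_carrier: "w \<in> carrier (free_group n) \<Longrightarrow> w \<star> [] = w"
  by (simp add: free_group_simps wmult_Nil_right)

lemma subst_aut_eq: "w \<in> carrier (free_group n) \<Longrightarrow> subst_aut n f w = subst_word f w"
  by (simp add: subst_aut_def)

lemma subst_aut_letter:
  "letter_map n f \<Longrightarrow> fst x < n \<Longrightarrow> subst_aut n f [x] = f x"
  using letter_mapD(1)[of n f x] by (simp add: subst_aut_eq letter_carrier wmult_Nil_carrier)

text \<open>The universal property makes \<open>word_val\<close> of the generator images a
  homomorphism, and the consistency in \<open>letter_map\<close> identifies it with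
  \<open>subst_word\<close>.\<close>

lemma subst_aut_hom:
  assumes "letter_map n f"
  shows "subst_aut n f \<in> hom (free_group n) (free_group n)"
proof -
  interpret F: group "free_group n" by (rule free_group_group)
  have lv: "letter_val (free_group n) (\<lambda>i. f (i, True)) x = f x" if "fst x < n" for x
  proof (cases x)
    case (Pair i b)
    then show ?thesis
      using that letter_mapD[OF assms, of "(i, True)"] inv_free_group[of "f (i, True)" n]
      by (cases b) (auto simp: letter_val_def letter_inv_def)
  qed
  have "word_val (free_group n) (\<lambda>i. f (i, True)) w = subst_word f w"
    if "set w \<subseteq> {..<n} \<times> UNIV" for w
    using that
    by (induction w) (auto simp: F.word_val_Cons lv free_group_simps, simp add: word_val_def free_group_simps)
  then have eq: "word_val (free_group n) (\<lambda>i. f (i, True)) w = subst_aut n f w"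
    if "w \<in> carrier (free_group n)" for w
    using that by (simp add: subst_aut_eq free_group_simps)
  have "word_val (free_group n) (\<lambda>i. f (i, True)) \<in> hom (free_group n) (free_group n)"
    using assms by (intro F.word_val_hom) (auto intro!: letter_mapD(1))
  then show ?thesis
    using F.m_closed by (simp add: hom_def Pi_def eq)
qed

lemma hom_free_group_ext:
  assumes "\<phi> \<in> hom (free_group n) (free_group n)" "\<psi> \<in> hom (free_group n) (free_group n)"
    and "\<And>x. fst x < n \<Longrightarrow> \<phi> [x] = \<psi> [x]" and "w \<in> carrier (free_group n)"
  shows "\<phi> w = \<psi> w"
  using assms(4)
proof (induction w)
  interpret p: group_hom "free_group n" "free_group n" \<phi>
    using assms(1) by (simp add: group_hom_def group_hom_axioms_def free_group_group)
  interpret q: group_hom "free_group n" "free_group n" \<psi>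
    using assms(2) by (simp add: group_hom_def group_hom_axioms_def free_group_group)
  {
    case Nil
    show ?case using p.hom_one q.hom_one by (simp add: free_group_simps)
  next
    case (Cons x w)
    show ?case
      using Cons_free_group[OF Cons.prems] Cons.IH assms(3)[of x]
        p.hom_mult[of "[x]" w] q.hom_mult[of "[x]" w] by simp
  }
qed

text \<open>Both composites are endomorphisms, so they need to be compared with the identity on
  letters only.\<close>

lemma subst_aut_auto:
  assumes "letter_map n f" "letter_map n g"
    and "\<And>x. fst x < n \<Longrightarrow> subst_word f (g x) = [x]" "\<And>x. fst x < n \<Longrightarrow> subst_word g (f x) = [x]"
  shows "subst_aut n f \<in> auto (free_group n)"
proof -
  interpret F: group "free_group n" by (rule free_group_group)
  let ?C = "carrier (free_group n)"
  note h = subst_aut_hom[OF assms(1)] subst_aut_hom[OF assms(2)]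
  have inv: "subst_aut n f (subst_aut n g w) = w"
    if "letter_map n f" "letter_map n g" "\<And>x. fst x < n \<Longrightarrow> subst_word f (g x) = [x]" "w \<in> ?C"
    for f g w
  proof -
    have "compose ?C (subst_aut n f) (subst_aut n g) \<in> hom (free_group n) (free_group n)"
      using F.hom_compose[OF subst_aut_hom[OF that(2)] subst_aut_hom[OF that(1)]] .
    moreover have "(\<lambda>x\<in>?C. x) \<in> hom (free_group n) (free_group n)"
      by (auto simp: hom_def)
    ultimately have "compose ?C (subst_aut n f) (subst_aut n g) w = (\<lambda>x\<in>?C. x) w"
    proof (rule hom_free_group_ext[OF _ _ _ that(4)])
      fix x :: letter assume x: "fst x < n"
      then have "g x \<in> ?C" using that(2) by (auto intro: letter_mapD(1))
      with x show "compose ?C (subst_aut n f) (subst_aut n g) [x] = (\<lambda>x\<in>?C. x) [x]"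
        using subst_aut_letter[OF that(2) x] by (simp add: compose_eq letter_carrier subst_aut_eq[of "g x"] that(3))
    qed
    then show ?thesis using that(4) by (simp add: compose_eq)
  qed
  have "subst_aut n f ` ?C \<subseteq> ?C" "subst_aut n g ` ?C \<subseteq> ?C"
    using h by (auto simp: hom_def)
  then have "bij_betw (subst_aut n f) ?C ?C"
    using inv[OF assms(1,2,3)] inv[OF assms(2,1,4)]
    by (intro bij_betw_byWitness[where f' = "subst_aut n g"]) auto
  moreover have "subst_aut n f \<in> extensional ?C"
    by (simp add: subst_aut_def)
  ultimately show ?thesis
    using h(1) unfolding auto_def Bij_def by blast
qed

lemma auto_extI:
  assumes "\<phi> \<in> auto (free_group n)" "\<psi> \<in> auto (free_group n)"
    and "\<And>x. fst x < n \<Longrightarrow> \<phi> [x] = \<psi> [x]"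
  shows "\<phi> = \<psi>"
proof -
  have h: "\<phi> \<in> hom (free_group n) (free_group n)" "\<psi> \<in> hom (free_group n) (free_group n)"
    and ext: "\<phi> \<in> extensional (carrier (free_group n))" "\<psi> \<in> extensional (carrier (free_group n))"
    using assms(1,2) unfolding auto_def Bij_def by blast+
  show ?thesis
    by (rule extensionalityI[OF ext hom_free_group_ext[OF h assms(3)]])
qed

lemma auto_mult_apply:
  assumes "\<phi> \<in> auto (free_group n)" "\<psi> \<in> auto (free_group n)" "w \<in> carrier (free_group n)"
  shows "(\<phi> \<otimes>\<^bsub>AutoGroup (free_group n)\<^esub> \<psi>) w = \<phi> (\<psi> w)"
  using assms by (simp add: AutoGroup_simps compose_eq)

lemma auto_mult_closed:
  assumes "\<phi> \<in> auto (free_group n)" "\<psi> \<in> auto (free_group n)"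
  shows "\<phi> \<otimes>\<^bsub>AutoGroup (free_group n)\<^esub> \<psi> \<in> auto (free_group n)"
  using assms group.AutoGroup[OF free_group_group, of n] monoid.m_closed[of "AutoGroup (free_group n)"]
  by (simp add: AutoGroup_simps group_def)

lemma auto_one_closed: "\<one>\<^bsub>AutoGroup (free_group n)\<^esub> \<in> auto (free_group n)"
  using group.id_in_auto[OF free_group_group, of n] by (simp add: AutoGroup_simps)

lemma auto_one_apply:
  assumes "w \<in> carrier (free_group n)"
  shows "\<one>\<^bsub>AutoGroup (free_group n)\<^esub> w = w"
  using assms by (simp add: AutoGroup_simps)

text \<open>Letting \<open>s\<close> be any letter covers multiplication on both sides: for
  \<open>s = (i, False)\<close> the generator \<open>x\<^sub>i\<close> is multiplied on the left by
  \<open>letter_inv t\<close>.\<close>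

definition transv :: "letter \<Rightarrow> letter \<Rightarrow> letter \<Rightarrow> letter list" where
  "transv s t x = (if x = s then [s, t] else if x = letter_inv s then [letter_inv t, letter_inv s] else [x])"

definition lswap :: "letter \<Rightarrow> letter \<Rightarrow> letter \<Rightarrow> letter" where
  "lswap s t x = (if x = s then t else if x = t then s
    else if x = letter_inv s then letter_inv t else if x = letter_inv t then letter_inv s else x)"

abbreviation tau :: "nat \<Rightarrow> letter \<Rightarrow> letter \<Rightarrow> letter list \<Rightarrow> letter list" where
  "tau n s t \<equiv> subst_aut n (transv s t)"

text \<open>For \<open>t = letter_inv s\<close> this is the inversion of a generator.\<close>

abbreviation sigma :: "nat \<Rightarrow> letter \<Rightarrow> letter \<Rightarrow> letter list \<Rightarrow> letter list" where
  "sigma n s t \<equiv> subst_aut n (\<lambda>x. [lswap s t x])"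

lemma letter_map_transv:
  assumes "fst s < n" "fst t < n" "fst s \<noteq> fst t"
  shows "letter_map n (transv s t)"
  using assms letter_neq[OF assms(3)]
  by (intro letter_mapI) (auto simp: transv_def free_group_simps reduced_Cons mem_Times_iff)

lemma lswap_lswap [simp]: "s \<noteq> t \<Longrightarrow> lswap s t (lswap s t x) = x"
  by (cases "x = s"; cases "x = t"; cases "x = letter_inv s"; cases "x = letter_inv t")
    (auto simp: lswap_def)

lemma lswap_inv: "s \<noteq> t \<Longrightarrow> lswap s t (letter_inv x) = letter_inv (lswap s t x)"
  by (cases "x = s"; cases "x = t"; cases "x = letter_inv s"; cases "x = letter_inv t")
    (auto simp: lswap_def)

lemma lswap_less: "fst s < n \<Longrightarrow> fst t < n \<Longrightarrow> fst x < n \<Longrightarrow> fst (lswap s t x) < n"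
  by (auto simp: lswap_def)

lemma lswap_eq_iff [simp]: "s \<noteq> t \<Longrightarrow> lswap s t x = lswap s t y \<longleftrightarrow> x = y"
  by (metis lswap_lswap)

lemma lswap_fst_eq_iff: "s \<noteq> t \<Longrightarrow> fst (lswap s t x) = fst (lswap s t y) \<longleftrightarrow> fst x = fst y"
  unfolding fst_eq_letter_iff by (simp flip: lswap_inv)

lemma letter_map_lswap:
  "fst s < n \<Longrightarrow> fst t < n \<Longrightarrow> s \<noteq> t \<Longrightarrow> letter_map n (\<lambda>x. [lswap s t x])"
  by (rule letter_mapI) (auto simp: letter_carrier lswap_less lswap_inv)

lemma tau_auto:
  assumes "fst s < n" "fst t < n" "fst s \<noteq> fst t"
  shows "tau n s t \<in> auto (free_group n)"
proof (rule subst_aut_auto[where g = "transv s (letter_inv t)"])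
  show "letter_map n (transv s t)" "letter_map n (transv s (letter_inv t))"
    using assms by (auto intro!: letter_map_transv)
qed (use letter_neq[OF assms(3)] in \<open>auto simp: transv_def\<close>)

lemma sigma_auto:
  assumes "fst s < n" "fst t < n" "s \<noteq> t"
  shows "sigma n s t \<in> auto (free_group n)"
  using assms by (intro subst_aut_auto[where g = "\<lambda>x. [lswap s t x]"]) (auto simp: letter_map_lswap)

lemma tau_letter:
  assumes "fst s < n" "fst t < n" "fst s \<noteq> fst t" "fst x < n"
  shows "tau n s t [x] = transv s t x"
  using assms by (intro subst_aut_letter letter_map_transv)

lemma sigma_letter:
  assumes "fst s < n" "fst t < n" "s \<noteq> t" "fst x < n"
  shows "sigma n s t [x] = [lswap s t x]"
  using assms by (simp add: subst_aut_letter letter_map_lswap)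

lemma transv_carrier:
  assumes "fst s < n" "fst t < n" "fst s \<noteq> fst t" "fst x < n"
  shows "transv s t x \<in> carrier (free_group n)"
  using assms letter_map_transv[OF assms(1-3)] by (auto intro: letter_mapD(1))

lemma auto_mult_subst_aut_letter:
  assumes "\<phi> \<in> auto (free_group n)" "subst_aut n g \<in> auto (free_group n)"
    and "letter_map n g" "fst z < n"
  shows "(\<phi> \<otimes>\<^bsub>AutoGroup (free_group n)\<^esub> subst_aut n g) [z] = \<phi> (g z)"
proof -
  have "[z] \<in> carrier (free_group n)"
    using assms(4) by (simp only: letter_carrier)
  then show ?thesis
    by (simp only: auto_mult_apply[OF assms(1,2)] subst_aut_letter[OF assms(3,4)])
qed

lemma subst_aut_mult_letter:
  assumes "subst_aut n f \<in> auto (free_group n)" "subst_aut n g \<in> auto (free_group n)"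
    and "letter_map n g" "fst z < n"
  shows "(subst_aut n f \<otimes>\<^bsub>AutoGroup (free_group n)\<^esub> subst_aut n g) [z] = subst_word f (g z)"
  by (simp only: auto_mult_subst_aut_letter[OF assms] subst_aut_eq[OF letter_mapD(1)[OF assms(3,4)]])

lemmas apply_simps = auto_mult_apply auto_mult_closed auto_one_apply letter_carrier tau_auto sigma_auto
  tau_letter sigma_letter lswap_less

lemmas mult_letter_simps = subst_aut_mult_letter auto_one_apply letter_carrier
  tau_auto sigma_auto letter_map_transv letter_map_lswap auto_mult_closed auto_one_closed
  lswap_less lswap_fst_eq_iff

section \<open>Relations among transvections and signed transpositions\<close>

lemma sigma_sigma:
  assumes "fst s < n" "fst t < n" "s \<noteq> t"
  shows "sigma n s t \<otimes>\<^bsub>AutoGroup (free_group n)\<^esub> sigma n s t = \<one>\<^bsub>AutoGroup (free_group n)\<^esub>"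
  using assms by (intro auto_extI[of _ n]) (simp_all add: mult_letter_simps)

lemma tau_tau_inv:
  assumes "fst s < n" "fst t < n" "fst s \<noteq> fst t"
  shows "tau n s t \<otimes>\<^bsub>AutoGroup (free_group n)\<^esub> tau n s (letter_inv t) = \<one>\<^bsub>AutoGroup (free_group n)\<^esub>"
proof (rule auto_extI[of _ n])
  fix x :: letter assume "fst x < n"
  then show "(tau n s t \<otimes>\<^bsub>AutoGroup (free_group n)\<^esub> tau n s (letter_inv t)) [x] = \<one>\<^bsub>AutoGroup (free_group n)\<^esub> [x]"
    using assms letter_neq[OF assms(3)]
    by (simp add: mult_letter_simps) (simp add: transv_def)
qed (use assms in \<open>simp_all add: mult_letter_simps\<close>)

text \<open>Conjugation by a signed transposition relabels letters. With the analogue for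
  transvections this supplies all but one of the conjugating elements for the four-groups.\<close>

lemma sigma_conj_sigma:
  assumes "fst s < n" "fst t < n" "s \<noteq> t" "fst x < n" "fst y < n" "x \<noteq> y"
  shows "sigma n s t \<otimes>\<^bsub>AutoGroup (free_group n)\<^esub> sigma n x y =
    sigma n (lswap s t x) (lswap s t y) \<otimes>\<^bsub>AutoGroup (free_group n)\<^esub> sigma n s t"
proof (rule auto_extI[of _ n])
  fix z :: letter assume z: "fst z < n"
  have "lswap s t (lswap x y z) = lswap (lswap s t x) (lswap s t y) (lswap s t z)"
    using assms by (simp add: lswap_def[of x y] lswap_def[of "lswap s t x"] flip: lswap_inv)
  then show "(sigma n s t \<otimes>\<^bsub>AutoGroup (free_group n)\<^esub> sigma n x y) [z] =
      (sigma n (lswap s t x) (lswap s t y) \<otimes>\<^bsub>AutoGroup (free_group n)\<^esub> sigma n s t) [z]"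
    using assms z by (simp add: mult_letter_simps)
qed (use assms in \<open>simp_all add: mult_letter_simps\<close>)

lemma sigma_conj_tau:
  assumes "fst s < n" "fst t < n" "s \<noteq> t" "fst x < n" "fst y < n" "fst x \<noteq> fst y"
  shows "sigma n s t \<otimes>\<^bsub>AutoGroup (free_group n)\<^esub> tau n x y =
    tau n (lswap s t x) (lswap s t y) \<otimes>\<^bsub>AutoGroup (free_group n)\<^esub> sigma n s t"
proof (rule auto_extI[of _ n])
  fix z :: letter assume z: "fst z < n"
  have "subst_word (\<lambda>x. [lswap s t x]) (transv x y z) = transv (lswap s t x) (lswap s t y) (lswap s t z)"
    using assms lswap_fst_eq_iff[of s t x y] letter_neq[OF assms(6)]
    by (simp add: transv_def flip: lswap_inv)
  then show "(sigma n s t \<otimes>\<^bsub>AutoGroup (free_group n)\<^esub> tau n x y) [z] =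
      (tau n (lswap s t x) (lswap s t y) \<otimes>\<^bsub>AutoGroup (free_group n)\<^esub> sigma n s t) [z]"
    using assms z by (simp add: mult_letter_simps wmult_Nil_carrier[OF transv_carrier, of _ n])
qed (use assms in \<open>simp_all add: mult_letter_simps\<close>)

text \<open>Left and right multiplications commute: both composites send \<open>s\<close> to
  \<open>u\<^sup>-\<^sup>1 s t\<close>. Once left and right transvections have the same image, the
  images of \<open>tau n s t\<close> and \<open>tau n s u\<close> commute.\<close>

lemma tau_commute:
  assumes "fst s < n" "fst t < n" "fst s \<noteq> fst t" "fst u < n" "fst s \<noteq> fst u"
  shows "tau n s t \<otimes>\<^bsub>AutoGroup (free_group n)\<^esub> tau n (letter_inv s) u =
    tau n (letter_inv s) u \<otimes>\<^bsub>AutoGroup (free_group n)\<^esub> tau n s t"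
proof (rule auto_extI[of _ n])
  fix z :: letter assume "fst z < n"
  then show "(tau n s t \<otimes>\<^bsub>AutoGroup (free_group n)\<^esub> tau n (letter_inv s) u) [z] =
    (tau n (letter_inv s) u \<otimes>\<^bsub>AutoGroup (free_group n)\<^esub> tau n s t) [z]"
    using assms
      letter_neq[OF assms(3)] letter_neq[OF assms(5)]
    by (simp add: mult_letter_simps) (simp add: transv_def)
qed (use assms in \<open>simp_all add: mult_letter_simps\<close>)

text \<open>Both sides send \<open>s\<close> to \<open>s t u\<close> and \<open>t\<close> to
  \<open>t u\<close>. Thus \<open>tau n t u\<close> conjugates \<open>tau n s t\<close> into its
  product with \<open>tau n s u\<close>, which is the role of \<open>v\<close> in
  \<open>klein_collapsing\<close>.\<close>

lemma tau_conj_tau: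
  assumes "fst s < n" "fst t < n" "fst u < n" "fst s \<noteq> fst t" "fst s \<noteq> fst u" "fst t \<noteq> fst u"
  shows "tau n t u \<otimes>\<^bsub>AutoGroup (free_group n)\<^esub> tau n s t =
    (tau n s t \<otimes>\<^bsub>AutoGroup (free_group n)\<^esub> tau n s u) \<otimes>\<^bsub>AutoGroup (free_group n)\<^esub> tau n t u"
proof (rule auto_extI[of _ n])
  fix z :: letter assume z: "fst z < n"
  note ne = letter_neq[OF assms(4)] letter_neq[OF assms(5)] letter_neq[OF assms(6)]
  consider "z = s" | "z = letter_inv s" | "z = t" | "z = letter_inv t" | "fst z \<noteq> fst s" "fst z \<noteq> fst t"
    using fst_eq_letter_iff by blast
  then show "(tau n t u \<otimes>\<^bsub>AutoGroup (free_group n)\<^esub> tau n s t) [z] =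
    ((tau n s t \<otimes>\<^bsub>AutoGroup (free_group n)\<^esub> tau n s u) \<otimes>\<^bsub>AutoGroup (free_group n)\<^esub> tau n t u) [z]"
  proof cases
    case 5
    then have "transv s t z = [z]" "transv s u z = [z]" "transv t u z = [z]"
      by (auto simp: transv_def)
    then show ?thesis
      using z assms by (simp add: apply_simps)
  qed (use z assms ne in \<open>simp add: apply_simps transv_def subst_aut_eq free_group_simps reduced_Cons mem_Times_iff\<close>)+
qed (use assms in \<open>simp_all add: mult_letter_simps\<close>)

text \<open>The factorisation of a transposition matrix into three elementary matrices and a sign
  change, lifted to the free group; the rightmost factor acts first.\<close>

lemma sigma_eq_tau:
  assumes "fst s < n" "fst t < n" "fst s \<noteq> fst t"
  shows "sigma n s t = tau n s t \<otimes>\<^bsub>AutoGroup (free_group n)\<^esub> (tau n t (letter_inv s) \<otimes>\<^bsub>AutoGroup (free_group n)\<^esub>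
    (tau n (letter_inv s) (letter_inv t) \<otimes>\<^bsub>AutoGroup (free_group n)\<^esub> sigma n t (letter_inv t)))"
proof (rule auto_extI[of _ n])
  fix z :: letter assume z: "fst z < n"
  note ne = letter_neq[OF assms(3)]
  consider "z = s" | "z = letter_inv s" | "z = t" | "z = letter_inv t" | "fst z \<noteq> fst s" "fst z \<noteq> fst t"
    using fst_eq_letter_iff by blast
  then show "sigma n s t [z] = (tau n s t \<otimes>\<^bsub>AutoGroup (free_group n)\<^esub> (tau n t (letter_inv s) \<otimes>\<^bsub>AutoGroup (free_group n)\<^esub>
    (tau n (letter_inv s) (letter_inv t) \<otimes>\<^bsub>AutoGroup (free_group n)\<^esub> sigma n t (letter_inv t)))) [z]"
  proof cases
    case 5
    then have "lswap s t z = z" "lswap t (letter_inv t) z = z" "transv s t z = [z]"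
      "transv t (letter_inv s) z = [z]" "transv (letter_inv s) (letter_inv t) z = [z]"
      by (auto simp: transv_def lswap_def)
    then show ?thesis
      using z assms ne by (simp add: apply_simps)
  qed (use z assms ne in \<open>simp add: apply_simps; simp add: lswap_def transv_def subst_aut_eq free_group_simps reduced_Cons mem_Times_iff\<close>)+
qed (use assms letter_neq[OF assms(3)] in \<open>auto simp: apply_simps\<close>)

section \<open>Homomorphisms to groups without conjugate Klein four-groups\<close>

text \<open>Stated for an arbitrary group because there are two targets: the homeomorphism group for
  the action and \<open>sign_img\<close> for the determinant.\<close>

definition klein_collapsing :: "('a, 'b) monoid_scheme \<Rightarrow> bool" where
  "klein_collapsing H \<longleftrightarrow> (\<forall>a\<in>carrier H. \<forall>b\<in>carrier H. \<forall>u\<in>carrier H. \<forall>v\<in>carrier H.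
    a \<otimes>\<^bsub>H\<^esub> a = \<one>\<^bsub>H\<^esub> \<longrightarrow> b \<otimes>\<^bsub>H\<^esub> b = \<one>\<^bsub>H\<^esub> \<longrightarrow> a \<otimes>\<^bsub>H\<^esub> b = b \<otimes>\<^bsub>H\<^esub> a \<longrightarrow>
    u \<otimes>\<^bsub>H\<^esub> a = b \<otimes>\<^bsub>H\<^esub> u \<longrightarrow> v \<otimes>\<^bsub>H\<^esub> a = a \<otimes>\<^bsub>H\<^esub> b \<otimes>\<^bsub>H\<^esub> v \<longrightarrow> a = \<one>\<^bsub>H\<^esub>)"

lemma klein_collapsingD:
  assumes "klein_collapsing H" "a \<in> carrier H" "b \<in> carrier H" "u \<in> carrier H" "v \<in> carrier H"
    and "a \<otimes>\<^bsub>H\<^esub> a = \<one>\<^bsub>H\<^esub>" "b \<otimes>\<^bsub>H\<^esub> b = \<one>\<^bsub>H\<^esub>" "a \<otimes>\<^bsub>H\<^esub> b = b \<otimes>\<^bsub>H\<^esub> a"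
    and "u \<otimes>\<^bsub>H\<^esub> a = b \<otimes>\<^bsub>H\<^esub> u" "v \<otimes>\<^bsub>H\<^esub> a = a \<otimes>\<^bsub>H\<^esub> b \<otimes>\<^bsub>H\<^esub> v"
  shows "a = \<one>\<^bsub>H\<^esub>"
  using assms unfolding klein_collapsing_def by blast

abbreviation eps :: "nat \<Rightarrow> nat \<Rightarrow> letter list \<Rightarrow> letter list" where
  "eps n i \<equiv> sigma n (i, True) (i, False)"

lemma lswap_eps: "lswap (i, True) (i, False) x = (if fst x = i then letter_inv x else x)"
  by (cases x) (auto simp: lswap_def letter_inv_def)

lemma lswap_index:
  "i \<noteq> j \<Longrightarrow> lswap (i, True) (j, True) (k, b) = (if k = i then j else if k = j then i else k, b)"
  by (cases b) (auto simp: lswap_def letter_inv_def)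

lemma (in group) intertwine_mult:
  assumes "u \<in> carrier G" "a \<in> carrier G" "b \<in> carrier G" "a' \<in> carrier G" "b' \<in> carrier G"
    and "u \<otimes> a = a' \<otimes> u" "u \<otimes> b = b' \<otimes> u"
  shows "u \<otimes> (a \<otimes> b) = a' \<otimes> b' \<otimes> u"
proof -
  have "u \<otimes> (a \<otimes> b) = a' \<otimes> (u \<otimes> b)"
    using assms(1-6) by (simp flip: m_assoc)
  also have "\<dots> = a' \<otimes> b' \<otimes> u"
    using assms by (simp add: m_assoc)
  finally show ?thesis .
qed

lemma sigma_letter_inv: "sigma n t (letter_inv t) = eps n (fst t)"
proof -
  have "lswap t (letter_inv t) x = lswap (fst t, True) (fst t, False) x" for x
    unfolding lswap_eps using fst_eq_letter_iff[of x t] by (auto simp: lswap_def)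
  then show ?thesis by simp
qed

section \<open>Images of the generators in rank at least three\<close>

context
  fixes n :: nat and H :: "('a, 'b) monoid_scheme" and h
  assumes h: "h \<in> hom (AutoGroup (free_group n)) H" and H: "group H" "klein_collapsing H"
    and n: "3 \<le> n"
begin

interpretation H: group H by (rule H(1))
interpretation h: group_hom "AutoGroup (free_group n)" H h
  using h H(1) group.AutoGroup[OF free_group_group, of n]
  by (simp add: group_hom_def group_hom_axioms_def)

text \<open>The rank bound enters here: two indices leave a third one free, from which the
  four-groups are built.\<close>

lemma third_index: obtains k where "k < n" "k \<noteq> i" "k \<noteq> j"
proof -
  have "card {..<n} > card {i, j}"
    using n card_insert_le_m1[of 2 "{j}" i] by (simp add: card_insert_if)
  then have "\<not> {..<n} \<subseteq> {i, j}"
    by (meson card_mono finite.emptyI finite.insertI not_le)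
  then show ?thesis using that by auto
qed

lemma hom_auto_closed: "\<phi> \<in> auto (free_group n) \<Longrightarrow> h \<phi> \<in> carrier H"
  using h.hom_closed by (simp add: AutoGroup_simps)

lemma hom_auto_mult:
  "\<phi> \<in> auto (free_group n) \<Longrightarrow> \<psi> \<in> auto (free_group n) \<Longrightarrow>
    h (\<phi> \<otimes>\<^bsub>AutoGroup (free_group n)\<^esub> \<psi>) = h \<phi> \<otimes>\<^bsub>H\<^esub> h \<psi>"
  using h.hom_mult by (simp add: AutoGroup_simps(1))

lemma hom_sigma_conj_sigma:
  assumes "fst s < n" "fst t < n" "s \<noteq> t" "fst x < n" "fst y < n" "x \<noteq> y"
  shows "h (sigma n s t) \<otimes>\<^bsub>H\<^esub> h (sigma n x y) =
    h (sigma n (lswap s t x) (lswap s t y)) \<otimes>\<^bsub>H\<^esub> h (sigma n s t)"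
  using assms arg_cong[OF sigma_conj_sigma[OF assms], of h]
  by (simp add: hom_auto_mult sigma_auto lswap_less)

lemma hom_sigma_conj_tau:
  assumes "fst s < n" "fst t < n" "s \<noteq> t" "fst x < n" "fst y < n" "fst x \<noteq> fst y"
  shows "h (sigma n s t) \<otimes>\<^bsub>H\<^esub> h (tau n x y) =
    h (tau n (lswap s t x) (lswap s t y)) \<otimes>\<^bsub>H\<^esub> h (sigma n s t)"
  using assms arg_cong[OF sigma_conj_tau[OF assms], of h]
  by (simp add: hom_auto_mult sigma_auto tau_auto lswap_less lswap_fst_eq_iff)

lemma hom_sigma_sigma:
  assumes "fst s < n" "fst t < n" "s \<noteq> t"
  shows "h (sigma n s t) \<otimes>\<^bsub>H\<^esub> h (sigma n s t) = \<one>\<^bsub>H\<^esub>"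
  using assms arg_cong[OF sigma_sigma[OF assms], of h] by (simp add: hom_auto_mult sigma_auto)

text \<open>With a third index \<open>k\<close>, the four-group is spanned by \<open>e i e j\<close>
  and \<open>e j e k\<close>, with product \<open>e i e k\<close>. Transposing \<open>i\<close> and
  \<open>k\<close> conjugates the first into the second; transposing \<open>j\<close> and
  \<open>k\<close> conjugates it into the product.\<close>

lemma collapse_eps_mult:
  assumes "i < n" "j < n" "i \<noteq> j"
  shows "h (eps n i) \<otimes>\<^bsub>H\<^esub> h (eps n j) = \<one>\<^bsub>H\<^esub>"
proof -
  obtain k where k: "k < n" "k \<noteq> i" "k \<noteq> j" by (rule third_index)
  define e where "e m = h (eps n m)" for m
  have c: "e m \<in> carrier H" "e m \<otimes>\<^bsub>H\<^esub> e m = \<one>\<^bsub>H\<^esub>" if "m < n" for m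
    using that hom_sigma_sigma[of "(m, True)" "(m, False)"] by (simp_all add: e_def hom_auto_closed sigma_auto)
  have comm: "e m \<otimes>\<^bsub>H\<^esub> e l = e l \<otimes>\<^bsub>H\<^esub> e m" if "m < n" "l < n" "l \<noteq> m" for l m
    using that hom_sigma_conj_sigma[of "(m, True)" "(m, False)" "(l, True)" "(l, False)"]
    by (simp add: e_def lswap_eps)
  have perm: "h (sigma n (l, True) (m, True)) \<otimes>\<^bsub>H\<^esub> e p =
      e (if p = l then m else if p = m then l else p) \<otimes>\<^bsub>H\<^esub> h (sigma n (l, True) (m, True))"
    if "m < n" "l < n" "l \<noteq> m" "p < n" for l m p
    using that hom_sigma_conj_sigma[of "(l, True)" "(m, True)" "(p, True)" "(p, False)"]
    by (simp add: e_def lswap_index)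
  have sc: "h (sigma n (l, True) (m, True)) \<in> carrier H" if "l < n" "m < n" "l \<noteq> m" for l m
    using that by (simp add: hom_auto_closed sigma_auto)
  have cancel: "e l \<otimes>\<^bsub>H\<^esub> e m \<otimes>\<^bsub>H\<^esub> (e m \<otimes>\<^bsub>H\<^esub> e p) = e l \<otimes>\<^bsub>H\<^esub> e p" if "l < n" "m < n" "p < n" for l m p
  proof -
    have "e m \<otimes>\<^bsub>H\<^esub> (e m \<otimes>\<^bsub>H\<^esub> e p) = e p"
      using that c by (simp flip: H.m_assoc)
    then show ?thesis using that c by (simp add: H.m_assoc)
  qed
  have a: "e l \<otimes>\<^bsub>H\<^esub> e m \<otimes>\<^bsub>H\<^esub> (e l \<otimes>\<^bsub>H\<^esub> e m) = \<one>\<^bsub>H\<^esub>" if "l < n" "m < n" "l \<noteq> m" for l m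
    using cancel[of l m l] comm[of l m] c that by simp
  have "e i \<otimes>\<^bsub>H\<^esub> e j = \<one>\<^bsub>H\<^esub>"
  proof (rule klein_collapsingD[OF H(2)])
    let ?u = "h (sigma n (i, True) (k, True))" and ?v = "h (sigma n (j, True) (k, True))"
    have "?u \<otimes>\<^bsub>H\<^esub> (e i \<otimes>\<^bsub>H\<^esub> e j) = e k \<otimes>\<^bsub>H\<^esub> e j \<otimes>\<^bsub>H\<^esub> ?u"
      using perm[of k i i] perm[of k i j] assms k c sc[of i k]
      by (intro H.intertwine_mult) auto
    then show "?u \<otimes>\<^bsub>H\<^esub> (e i \<otimes>\<^bsub>H\<^esub> e j) = e j \<otimes>\<^bsub>H\<^esub> e k \<otimes>\<^bsub>H\<^esub> ?u"
      using comm[of j k] assms k by simp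
    have "?v \<otimes>\<^bsub>H\<^esub> (e i \<otimes>\<^bsub>H\<^esub> e j) = e i \<otimes>\<^bsub>H\<^esub> e k \<otimes>\<^bsub>H\<^esub> ?v"
      using perm[of k j i] perm[of k j j] assms k c sc[of j k]
      by (intro H.intertwine_mult) auto
    then show "?v \<otimes>\<^bsub>H\<^esub> (e i \<otimes>\<^bsub>H\<^esub> e j) = e i \<otimes>\<^bsub>H\<^esub> e j \<otimes>\<^bsub>H\<^esub> (e j \<otimes>\<^bsub>H\<^esub> e k) \<otimes>\<^bsub>H\<^esub> ?v"
      using cancel[of i j k] assms k by simp
    show "e i \<otimes>\<^bsub>H\<^esub> e j \<otimes>\<^bsub>H\<^esub> (e j \<otimes>\<^bsub>H\<^esub> e k) = e j \<otimes>\<^bsub>H\<^esub> e k \<otimes>\<^bsub>H\<^esub> (e i \<otimes>\<^bsub>H\<^esub> e j)"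
      using cancel[of k j i] cancel[of i j k] comm[of j k] comm[of i j] comm[of i k] assms k by simp
  qed (use assms k c sc a in auto)
  then show ?thesis by (simp add: e_def)
qed

lemma collapse_eps_eq:
  assumes "i < n" "j < n"
  shows "h (eps n i) = h (eps n j)"
proof (cases "i = j")
  case False
  have "h (eps n m) \<in> carrier H" if "m < n" for m
    using that by (simp add: hom_auto_closed sigma_auto)
  then show ?thesis
    using collapse_eps_mult[OF assms False] hom_sigma_sigma[of "(j, True)" "(j, False)"] assms
      H.r_cancel[of "h (eps n i)" "h (eps n j)" "h (eps n j)"] by simp
qed simp

lemma collapse_tau:
  assumes "fst s < n" "fst t < n" "fst s \<noteq> fst t"
  shows "h (tau n s t) = \<one>\<^bsub>H\<^esub>"
proof -
  have e: "h (eps n i) \<in> carrier H" if "i < n" for i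
    using that by (simp add: hom_auto_closed sigma_auto)
  have T: "h (tau n x y) \<in> carrier H" if "fst x < n" "fst y < n" "fst x \<noteq> fst y" for x y
    using that by (simp add: hom_auto_closed tau_auto)
  have conj: "h (tau n (lswap (i, True) (i, False) x) (lswap (i, True) (i, False) y)) =
      h (eps n i) \<otimes>\<^bsub>H\<^esub> h (tau n x y) \<otimes>\<^bsub>H\<^esub> inv\<^bsub>H\<^esub> h (eps n i)"
    if "i < n" "fst x < n" "fst y < n" "fst x \<noteq> fst y" for i x y
    using that e T hom_sigma_conj_tau[of "(i, True)" "(i, False)" x y]
    by (subst H.inv_solve_right) (simp_all add: lswap_less lswap_fst_eq_iff)
  \<comment> \<open>Inverting a third generator commutes with the transvection, and all inversions
    have the same image; hence conjugating by the inversion belonging to \<open>x\<close> or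
    \<open>y\<close> does not change the image either.\<close>
  have flip: "h (tau n (letter_inv x) y) = h (tau n x y)" "h (tau n x (letter_inv y)) = h (tau n x y)"
    if xy: "fst x < n" "fst y < n" "fst x \<noteq> fst y" for x y
  proof -
    obtain k where k: "k < n" "k \<noteq> fst x" "k \<noteq> fst y" by (rule third_index)
    have "h (tau n (letter_inv x) y) = h (eps n (fst x)) \<otimes>\<^bsub>H\<^esub> h (tau n x y) \<otimes>\<^bsub>H\<^esub> inv\<^bsub>H\<^esub> h (eps n (fst x))"
      "h (tau n x (letter_inv y)) = h (eps n (fst y)) \<otimes>\<^bsub>H\<^esub> h (tau n x y) \<otimes>\<^bsub>H\<^esub> inv\<^bsub>H\<^esub> h (eps n (fst y))"
      "h (tau n x y) = h (eps n k) \<otimes>\<^bsub>H\<^esub> h (tau n x y) \<otimes>\<^bsub>H\<^esub> inv\<^bsub>H\<^esub> h (eps n k)"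
      using conj[OF _ xy, of "fst x"] conj[OF _ xy, of "fst y"] conj[OF k(1) xy] xy k
      by (simp_all add: lswap_eps)
    then show "h (tau n (letter_inv x) y) = h (tau n x y)" "h (tau n x (letter_inv y)) = h (tau n x y)"
      using collapse_eps_eq[OF k(1)] xy by metis+
  qed
  \<comment> \<open>\<open>tau n x (letter_inv y)\<close> is the inverse of
    \<open>tau n x y\<close>, and by \<open>flip\<close> it has the same image.\<close>
  have invol: "h (tau n x y) \<otimes>\<^bsub>H\<^esub> h (tau n x y) = \<one>\<^bsub>H\<^esub>" if xy: "fst x < n" "fst y < n" "fst x \<noteq> fst y" for x y
    using arg_cong[OF tau_tau_inv[OF xy], of h] xy flip[OF xy] by (simp add: hom_auto_mult tau_auto)
  obtain k where k: "k < n" "k \<noteq> fst s" "k \<noteq> fst t" by (rule third_index)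
  define u where "u = (k, True)"
  have u: "fst u < n" "fst s \<noteq> fst u" "fst t \<noteq> fst u" using k by (auto simp: u_def)
  show ?thesis
  proof (rule klein_collapsingD[OF H(2)])
    show "h (tau n s t) \<otimes>\<^bsub>H\<^esub> h (tau n s u) = h (tau n s u) \<otimes>\<^bsub>H\<^esub> h (tau n s t)"
      using arg_cong[OF tau_commute[OF assms u(1,2)], of h] assms u flip(1)[of s u]
      by (simp add: hom_auto_mult tau_auto)
    have "lswap t u s = s" "lswap t u t = u"
      using assms u by (auto simp: lswap_def)
    then show "h (sigma n t u) \<otimes>\<^bsub>H\<^esub> h (tau n s t) = h (tau n s u) \<otimes>\<^bsub>H\<^esub> h (sigma n t u)"
      using hom_sigma_conj_tau[of t u s t] assms u by auto
    show "h (tau n t u) \<otimes>\<^bsub>H\<^esub> h (tau n s t) = h (tau n s t) \<otimes>\<^bsub>H\<^esub> h (tau n s u) \<otimes>\<^bsub>H\<^esub> h (tau n t u)"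
      using arg_cong[OF tau_conj_tau[OF assms(1,2) u(1) assms(3) u(2,3)], of h] assms u
      by (simp add: hom_auto_mult tau_auto auto_mult_closed)
    show "h (sigma n t u) \<in> carrier H"
      using assms u by (intro hom_auto_closed sigma_auto) auto
  qed (use assms u T invol in auto)
qed

lemma collapse_sigma:
  assumes "fst s < n" "fst t < n" "s \<noteq> t" "i < n"
  shows "h (sigma n s t) = h (eps n i)"
proof (cases "fst s = fst t")
  case True
  then have "t = letter_inv s" using assms(3) fst_eq_letter_iff[of s t] by auto
  then show ?thesis using assms collapse_eps_eq[of "fst s" i] by (simp add: sigma_letter_inv)
next
  case False
  have "h (eps n (fst t)) \<in> carrier H" using assms by (simp add: hom_auto_closed sigma_auto)
  then have "h (sigma n s t) = h (eps n (fst t))"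
    using assms False
    by (subst sigma_eq_tau) (simp_all add: hom_auto_mult tau_auto sigma_auto auto_mult_closed collapse_tau sigma_letter_inv)
  then show ?thesis using collapse_eps_eq[of "fst t" i] assms by simp
qed

end

section \<open>Nielsen cancellation\<close>

lemma reduced_append_iff:
  "reduced (u @ v) \<longleftrightarrow>
    reduced u \<and> reduced v \<and> (u = [] \<or> v = [] \<or> hd v \<noteq> letter_inv (last u))"
  by (auto simp: reduced_def successively_append_iff)

lemma length_push: "length (push x w) = Suc (length w) \<and> push x w = x # w \<or> length (push x w) < length w"
  by (cases w) auto

lemma length_wmult_le: "length (u \<star> v) \<le> length u + length v"
proof (induction u)
  case (Cons x u)
  then show ?case using length_push[of x "u \<star> v"] by auto
qed simp

lemma wmult_eq_append: "length (u \<star> v) = length u + length v \<Longrightarrow> u \<star> v = u @ v"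
proof (induction u)
  case (Cons x u)
  have "push x (u \<star> v) = x # (u \<star> v)" "length (u \<star> v) = length u + length v"
    using length_push[of x "u \<star> v"] length_wmult_le[of u v] Cons.prems by (elim disjE; simp)+
  then show ?case using Cons.IH by simp
qed simp

lemma wmult_reduced_append: "reduced (u @ v) \<Longrightarrow> u \<star> v = u @ v"
proof (induction u)
  case (Cons x u)
  then show ?case using push_Cons_reduced[of x "u @ v"] by (simp add: reduced_Cons)
qed simp

lemma wmult_cancel: "(a @ d) \<star> (word_inv d @ b) = a \<star> b"
proof -
  have "d \<star> (word_inv d @ b) = b"
    by (induction d arbitrary: b) simp_all
  then show ?thesis by simp
qed

lemma wmult_decompose:
  assumes "reduced u" "reduced v"
  obtains a d b where "u = a @ d" "v = word_inv d @ b" "u \<star> v = a @ b" "reduced (a @ b)"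
proof -
  have "\<exists>a d b. u = a @ d \<and> v = word_inv d @ b \<and> u \<star> v = a @ b \<and> reduced (a @ b)"
    using assms
  proof (induction u)
    case Nil
    then show ?case by (intro exI[of _ "[]"] exI[of _ v]) simp
  next
    case (Cons x u)
    then obtain a d b where u: "u = a @ d" "v = word_inv d @ b" "u \<star> v = a @ b" "reduced (a @ b)"
      by (auto simp: reduced_Cons)
    show ?case
    proof (cases "a = [] \<and> b \<noteq> [] \<and> hd b = letter_inv x")
      \<comment> \<open>\<open>x\<close> meets \<open>b\<close> only when all of \<open>u\<close>
        has cancelled; otherwise it stands before a surviving letter of the reduced word
        \<open>x # u\<close>.\<close>
      case True
      then obtain b' where "b = letter_inv x # b'" by (cases b) auto
      then show ?thesis
        using u True
        by (intro exI[of _ "[]"] exI[of _ "x # u"] exI[of _ b']) (auto simp: reduced_Cons)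
    next
      case False
      have "reduced (x # a @ b)"
        using False u Cons.prems by (cases a) (auto simp: reduced_Cons)
      then show ?thesis
        using u push_Cons_reduced[of x "a @ b"]
        by (intro exI[of _ "x # a"] exI[of _ d] exI[of _ b]) simp
    qed
  qed
  then show ?thesis using that by blast
qed

text \<open>The outer letters of such a word are inverse to each other and the middle is again its
  own inverse. Peeling ends at a single letter or at two adjacent inverse letters, and neither is
  possible.\<close>

lemma word_inv_eq_self:
  assumes "reduced w" "word_inv w = w"
  shows "w = []"
  using assms
proof (induction w rule: length_induct)
  case (1 w)
  show ?case
  proof (cases w)
    case x: (Cons x m)
    show ?thesis
    proof (cases m rule: rev_cases)
      case Nil
      then show ?thesis using 1 x by simp
    next
      case y: (snoc m' y)
      have "reduced m'" "word_inv m' = m'" "y = letter_inv x"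
        using 1(2,3) x y by (auto simp: reduced_Cons reduced_append_iff)
      then have "m' = []"
        using 1(1) x y by simp
      then show ?thesis
        using 1(2) x y \<open>y = letter_inv x\<close> by (simp add: reduced_Cons)
    qed
  qed simp
qed

lemma reduced_inv_append:
  assumes "reduced (word_inv d @ d)"
  shows "d = []"
  using assms by (cases d) (auto simp: reduced_append_iff reduced_Cons)

text \<open>If \<open>d\<close> were at least half of \<open>u\<close>, the two occurrences would
  overlap: \<open>word_inv d = a @ e\<close> and \<open>d = e @ b\<close>. Then \<open>e\<close> is
  its own inverse, hence empty, and \<open>u = word_inv b @ b\<close> is not reduced.\<close>

lemma self_cancellation:
  assumes "reduced u" "u \<noteq> []" "u = a @ d" "u = word_inv d @ b"
  shows "2 * length d < length u"
proof (rule ccontr)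
  assume long: "\<not> 2 * length d < length u"
  have len: "length a = length b" "length a \<le> length d"
    using long assms(3,4) by (auto dest: arg_cong[of _ _ length])
  define e where "e = drop (length a) (word_inv d)"
  have "a = take (length a) (word_inv d)"
    using arg_cong[OF assms(4), of "take (length a)"] assms(3) len by simp
  then have e: "word_inv d = a @ e"
    unfolding e_def by (metis append_take_drop_id)
  then have "d = e @ b"
    using assms(3,4) by simp
  note e = e this
  have "word_inv b @ word_inv e = a @ e"
    using e by simp
  then have "word_inv e = e" and a: "a = word_inv b"
    using len by simp_all
  moreover have "reduced e"
    using assms(1,3) e by (simp add: reduced_append_iff)
  ultimately have "e = []"
    using word_inv_eq_self by blast
  then have "u = word_inv b @ b"
    using a e assms(3) by simp
  then show False
    using reduced_inv_append[of b] assms(1,2) by auto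
qed

text \<open>Minimising the total length alone leaves words that cancel exactly half against a neighbour on
  either side. As in Nielsen's proof, this is excluded by also minimising a numerical encoding of the initial
  halves of the words and of their inverses.\<close>

definition half :: "letter list \<Rightarrow> letter list" where
  "half w = take ((length w + 1) div 2) w"

text \<open>The word read as a numeral in base \<open>2 * n\<close> with letters as digits. On words
  of equal length in the first \<open>n\<close> generators this is injective and orders them
  lexicographically.\<close>

definition rank :: "nat \<Rightarrow> letter list \<Rightarrow> nat" where
  "rank n w = foldl (\<lambda>a x. a * (2 * n) + (2 * fst x + of_bool (snd x))) 0 w"

lemma rank_snoc: "rank n (w @ [x]) = rank n w * (2 * n) + (2 * fst x + of_bool (snd x))"
  by (simp add: rank_def)

lemma rank_append: "rank n (u @ v) = rank n u * (2 * n) ^ length v + rank n v"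
proof (induction v rule: rev_induct)
  case (snoc x v)
  then show ?case
    by (simp add: rank_snoc algebra_simps flip: append_assoc)
qed (simp add: rank_def)

lemma rank_inject:
  assumes "rank n u = rank n v" "length u = length v"
    "set u \<subseteq> {..<n} \<times> UNIV" "set v \<subseteq> {..<n} \<times> UNIV"
  shows "u = v"
  using assms
proof (induction u arbitrary: v rule: rev_induct)
  case (snoc x u)
  then obtain v' y where v: "v = v' @ [y]" by (cases v rule: rev_cases) auto
  let ?c = "\<lambda>x::letter. 2 * fst x + of_bool (snd x)"
  have lt: "?c x < 2 * n" "?c y < 2 * n"
    using snoc.prems v by (auto simp: mem_Times_iff)
  have eq: "rank n u * (2 * n) + ?c x = rank n v' * (2 * n) + ?c y"
    using snoc.prems(1) v by (simp add: rank_snoc)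
  have "?c x = ?c y"
    using arg_cong[OF eq, of "\<lambda>m. m mod (2 * n)"] lt by simp
  moreover have "rank n u = rank n v'"
    using arg_cong[OF eq, of "\<lambda>m. m div (2 * n)"] lt by simp
  moreover have "x = y" if "?c x = ?c y"
    using that by (cases x; cases y) (auto simp: of_bool_def split: if_splits, presburger+)
  ultimately show ?case
    using snoc.IH[of v'] snoc.prems v by auto
qed simp

text \<open>The initial half of \<open>p @ b\<close> contains \<open>p\<close>, while that of its
  inverse stops within the inverse of \<open>b\<close>; exchanging \<open>p\<close> for
  \<open>q\<close> is felt at one end only.\<close>

lemma rank_half_less:
  assumes "rank n p < rank n q" "length p = length q" "length q \<le> length b" "0 < n"
  shows "rank n (half (p @ b)) < rank n (half (q @ b))"
    and "half (word_inv (p @ b)) = half (word_inv (q @ b))"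
proof -
  let ?c = "take ((length p + length b + 1) div 2 - length p) b"
  have "half (p @ b) = p @ ?c" "half (q @ b) = q @ ?c"
    using assms by (auto simp: half_def)
  then show "rank n (half (p @ b)) < rank n (half (q @ b))"
    using assms by (simp add: rank_append)
  show "half (word_inv (p @ b)) = half (word_inv (q @ b))"
    using assms by (simp add: half_def)
qed

text \<open>The second condition is a tie-break in place of Nielsen's condition on triple products:
  \<open>q\<close> is exactly half as long as \<open>U s\<close>, and multiplying \<open>U t\<close>
  on the left by \<open>U s\<close> turns its prefix \<open>q\<close> into the equally long
  \<open>p\<close>.\<close>

definition nielsen_reduced :: "nat \<Rightarrow> (letter \<Rightarrow> letter list) \<Rightarrow> bool" where
  "nielsen_reduced n U \<longleftrightarrow>
    (\<forall>s t. fst s < n \<longrightarrow> fst t < n \<longrightarrow> fst s \<noteq> fst t \<longrightarrow> length (U s) \<le> length (U s \<star> U t)) \<and>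
    (\<forall>s t p q b. fst s < n \<longrightarrow> fst t < n \<longrightarrow> fst s \<noteq> fst t \<longrightarrow>
      U s = p @ word_inv q \<longrightarrow> U t = q @ b \<longrightarrow> length p = length q \<longrightarrow> rank n q \<le> rank n p)"

section \<open>Products of Nielsen-reduced words\<close>

context
  fixes n and U :: "letter \<Rightarrow> letter list"
  assumes lm: "letter_map n U" and ne: "\<And>s. fst s < n \<Longrightarrow> U s \<noteq> []"
    and red: "nielsen_reduced n U"
begin

lemma U_reduced: "fst s < n \<Longrightarrow> reduced (U s)"
  and U_set: "fst s < n \<Longrightarrow> set (U s) \<subseteq> {..<n} \<times> UNIV"
  and U_inv: "fst s < n \<Longrightarrow> U (letter_inv s) = word_inv (U s)"
  using letter_mapD[OF lm, of s] by (auto simp: free_group_simps)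

text \<open>For different generators the length condition bounds \<open>d\<close> by half of
  \<open>U t\<close>, and the inverted pair gives the bound for \<open>U s\<close>; the case
  \<open>s = t\<close> is \<open>self_cancellation\<close>.\<close>

lemma cancellation_le_half:
  assumes "fst s < n" "fst t < n" "t \<noteq> letter_inv s" "U s = a @ d" "U t = word_inv d @ b"
  shows "2 * length d \<le> length (U s)" "2 * length d \<le> length (U t)"
proof -
  have *: "2 * length d \<le> length (U t)"
    if "fst s < n" "fst t < n" "fst s \<noteq> fst t" "U s = a @ d" "U t = word_inv d @ b" for s t a d b
  proof -
    have "length (U s) \<le> length (U s \<star> U t)"
      using red that unfolding nielsen_reduced_def by blast
    also have "U s \<star> U t = a \<star> b"
      using that by (simp only: wmult_cancel)
    also have "length (a \<star> b) \<le> length a + length b"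
      by (rule length_wmult_le)
    finally show ?thesis using that by simp
  qed
  show "2 * length d \<le> length (U s)"
  proof (cases "fst s = fst t")
    case True
    then have "t = s" using assms(3) fst_eq_letter_iff[of t s] by auto
    then show ?thesis
      using self_cancellation[OF U_reduced[OF assms(1)] ne[OF assms(1)] assms(4), of b] assms(5) by simp
  next
    case False
    then show ?thesis
      using *[of "letter_inv t" "letter_inv s" "word_inv b" d "word_inv a"] assms by (auto simp: U_inv)
  qed
  show "2 * length d \<le> length (U t)"
  proof (cases "fst s = fst t")
    case True
    then have "t = s" using assms(3) fst_eq_letter_iff[of t s] by auto
    then show ?thesis
      using self_cancellation[OF U_reduced[OF assms(1)] ne[OF assms(1)] assms(4), of b] assms(5) by simp
  next
    case False
    then show ?thesis using *[of s t] assms by auto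
  qed
qed

text \<open>The rank condition for \<open>y\<close>, \<open>z\<close> and for the inverted pair
  \<open>y\<close>, \<open>x\<close> gives both inequalities between the ranks of \<open>p\<close>
  and \<open>q\<close>. So \<open>p = q\<close>, and \<open>U y = p @ word_inv p\<close> is not
  reduced.\<close>

lemma not_both_halves_cancel:
  assumes "fst x < n" "fst y < n" "fst z < n" "y \<noteq> letter_inv x" "z \<noteq> letter_inv y"
    and U: "U x = a @ word_inv p" "U y = p @ word_inv q" "U z = q @ b" "length p = length q"
  shows False
proof -
  have leq: "rank n q \<le> rank n p"
    if "fst s < n" "fst t < n" "fst s \<noteq> fst t" "U s = p @ word_inv q" "U t = q @ b" "length p = length q"
    for s t p q b
    using red that unfolding nielsen_reduced_def by blast
  have "fst x \<noteq> fst y"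
  proof
    assume "fst x = fst y"
    then have "x = y" using assms(4) fst_eq_letter_iff[of x y] by auto
    then show False
      using self_cancellation[OF U_reduced[OF assms(2)] ne[OF assms(2)], of a "word_inv p" "word_inv q"] U by simp
  qed
  then have "rank n p \<le> rank n q"
    using leq[of "letter_inv y" "letter_inv x" q p "word_inv a"] assms by (simp add: U_inv)
  moreover have "fst y \<noteq> fst z"
  proof
    assume "fst y = fst z"
    then have "y = z" using assms(5) fst_eq_letter_iff[of y z] by auto
    then have "2 * length (word_inv q) < length (U y)"
      using U(3) by (intro self_cancellation[OF U_reduced[OF assms(2)] ne[OF assms(2)] U(2), of b]) simp
    then show False using arg_cong[OF U(2), of length] U(4) by simp
  qed
  then have "rank n q \<le> rank n p"
    using leq[of y z p q b] assms by simp
  moreover have "set p \<subseteq> {..<n} \<times> UNIV" "set q \<subseteq> {..<n} \<times> UNIV"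
    using U_set[OF assms(2)] U_set[OF assms(3)] U by auto
  ultimately have "p = q"
    using U(4) rank_inject[of n p q] by simp
  then have "word_inv p = []"
    using U_reduced[OF assms(2)] U(2) reduced_inv_append[of "word_inv p"] by simp
  then show False using U(2) \<open>p = q\<close> ne[OF assms(2)] by simp
qed

text \<open>The prefix \<open>m\<close> of \<open>U y\<close> survives in the product, and the rest \<open>d\<close> is the part
  cancelled against the next factor.\<close>

lemma nielsen_product:
  assumes "reduced (y # w)" "set (y # w) \<subseteq> {..<n} \<times> UNIV"
  shows "\<exists>m d v. subst_word U (y # w) = m @ v \<and> reduced (m @ v) \<and> U y = m @ d \<and> m \<noteq> [] \<and>
    length w \<le> length v \<and> 2 * length d \<le> length (U y) \<and>
    (d = [] \<or> (\<exists>z b. fst z < n \<and> z \<noteq> letter_inv y \<and> U z = word_inv d @ b))"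
  using assms
proof (induction w arbitrary: y)
  case Nil
  then have y: "fst y < n" by auto
  then show ?case
    using ne[OF y] U_reduced[OF y]
    by (intro exI[of _ "U y"] exI[of _ "[]"]) (simp add: wmult_Nil_right)
next
  case (Cons y w x)
  have xy: "fst x < n" "fst y < n" "y \<noteq> letter_inv x" "reduced (y # w)"
    "set (y # w) \<subseteq> {..<n} \<times> UNIV"
    using Cons.prems by (auto simp: reduced_Cons)
  obtain m d v where IH: "subst_word U (y # w) = m @ v" "reduced (m @ v)" "U y = m @ d" "m \<noteq> []"
    "length w \<le> length v" "2 * length d \<le> length (U y)"
    "d = [] \<or> (\<exists>z b. fst z < n \<and> z \<noteq> letter_inv y \<and> U z = word_inv d @ b)"
    using Cons.IH[OF xy(4,5)] by blast
  obtain a e f where aef: "U x = a @ e" "U y = word_inv e @ f" "U x \<star> U y = a @ f" "reduced (a @ f)"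
    using wmult_decompose[OF U_reduced[OF xy(1)] U_reduced[OF xy(2)]] by blast
  have le: "2 * length e \<le> length (U x)" "2 * length e \<le> length (U y)"
    using cancellation_le_half[OF xy(1-3) aef(1,2)] by simp_all
  \<comment> \<open>Neither \<open>e\<close> nor \<open>d\<close> exceeds half of
    \<open>U y\<close>. If \<open>m\<close> were used up by \<open>e\<close>, both would be exact
    halves, and the neighbour \<open>z\<close> kept in the induction hypothesis completes the
    excluded configuration.\<close>
  have "length e < length m"
  proof (rule ccontr)
    assume "\<not> length e < length m"
    then have eq: "length e = length m" "length d = length e"
      using le(2) IH(3,6) by auto
    then have "m = word_inv e"
      using IH(3) aef(2) by simp
    moreover have "d \<noteq> []" using eq IH(4) by auto
    then obtain z b where "fst z < n" "z \<noteq> letter_inv y" "U z = word_inv d @ b"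
      using IH(7) by blast
    ultimately show False
      using IH(3) eq(2) aef(1) xy(1-3)
      by (intro not_both_halves_cancel[of x y z a "word_inv e" "word_inv d" b]) simp_all
  qed
  then obtain m' where m': "m = word_inv e @ m'" "f = m' @ d" "m' \<noteq> []"
  proof (intro that[of "drop (length e) m"])
    have "m @ d = word_inv e @ f" using IH(3) aef(2) by simp
    then have "take (length e) m = word_inv e" and f: "drop (length e) m @ d = f"
      using \<open>length e < length m\<close> by (simp_all add: append_eq_append_conv_if)
    then show "m = word_inv e @ drop (length e) m"
      by (metis append_take_drop_id)
    show "f = drop (length e) m @ d" using f by simp
  qed simp
  have r: "reduced (a @ m' @ v)"
    using aef(4) IH(2) m' by (auto simp: reduced_append_iff)
  have "subst_word U (x # y # w) = (a @ e) \<star> (word_inv e @ m' @ v)"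
    using IH(1) aef(1) m'(1) by simp
  also have "\<dots> = a @ m' @ v"
    using r by (simp only: wmult_cancel wmult_reduced_append)
  finally have "subst_word U (x # y # w) = a @ m' @ v" .
  moreover have "a \<noteq> []"
    using le(1) aef(1) ne[OF xy(1)] by auto
  moreover have "length (y # w) \<le> length (m' @ v)"
    using IH(5) m'(3) by (cases m') auto
  ultimately show ?case
    using r aef(1,2) xy le(1) by (intro exI[of _ a] exI[of _ e] exI[of _ "m' @ v"]) auto
qed

text \<open>Every letter of \<open>w\<close> leaves a survivor. Applied to the preimage of a letter,
  this shows that the preimage is itself at most one letter long.\<close>

lemma nielsen_length_le:
  assumes "w \<in> carrier (free_group n)"
  shows "length w \<le> length (subst_word U w)"
proof (cases w)
  case (Cons y v)
  then obtain m d z where "subst_word U w = m @ z" "m \<noteq> []" "length v \<le> length z"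
    using nielsen_product[of y v] assms by (auto simp: free_group_simps)
  then show ?thesis using Cons by (cases m) auto
qed simp

end

section \<open>Nielsen's theorem\<close>

lemma auto_hom: "\<phi> \<in> auto (free_group n) \<Longrightarrow> \<phi> \<in> hom (free_group n) (free_group n)"
  by (simp add: auto_def)

lemma auto_letter_map:
  assumes "\<phi> \<in> auto (free_group n)"
  shows "letter_map n (\<lambda>x. \<phi> [x])"
proof (rule letter_mapI)
  interpret p: group_hom "free_group n" "free_group n" \<phi>
    using auto_hom[OF assms] by (simp add: group_hom_def group_hom_axioms_def free_group_group)
  fix x :: letter assume x: "fst x < n"
  then have xc: "[x] \<in> carrier (free_group n)" by (simp add: letter_carrier)
  then show "\<phi> [x] \<in> carrier (free_group n)" by (rule p.hom_closed)
  then show "\<phi> [letter_inv x] = word_inv (\<phi> [x])"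
    using p.hom_inv[OF xc] xc by (simp add: inv_free_group)
qed

lemma auto_eq_subst_word:
  assumes "\<phi> \<in> auto (free_group n)" "w \<in> carrier (free_group n)"
  shows "\<phi> w = subst_word (\<lambda>x. \<phi> [x]) w"
proof -
  have "\<phi> w = subst_aut n (\<lambda>x. \<phi> [x]) w"
    using auto_hom[OF assms(1)] subst_aut_hom[OF auto_letter_map[OF assms(1)]] _ assms(2)
  proof (rule hom_free_group_ext)
    show "\<phi> [x] = subst_aut n (\<lambda>x. \<phi> [x]) [x]" if "fst x < n" for x
      using subst_aut_letter[OF auto_letter_map[OF assms(1)] that] by simp
  qed
  then show ?thesis using assms(2) by (simp add: subst_aut_eq)
qed

lemma auto_inj:
  assumes "\<phi> \<in> auto (free_group n)" "u \<in> carrier (free_group n)" "v \<in> carrier (free_group n)" "\<phi> u = \<phi> v"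
  shows "u = v"
  using assms by (auto simp: auto_def Bij_def bij_betw_def dest: inj_onD)

lemma auto_letter_ne:
  assumes "\<phi> \<in> auto (free_group n)" "fst x < n"
  shows "\<phi> [x] \<noteq> []"
proof
  assume "\<phi> [x] = []"
  moreover have "\<phi> [] = []"
    using auto_eq_subst_word[OF assms(1), of "[]"] by (simp add: free_group_simps)
  ultimately have "\<phi> [x] = \<phi> []" by simp
  moreover have "[x] \<in> carrier (free_group n)" "[] \<in> carrier (free_group n)"
    using assms(2) by (simp only: letter_carrier) (simp add: free_group_simps)
  ultimately have "[x] = []"
    using auto_inj[OF assms(1)] by blast
  then show False by simp
qed

definition nielsen_gens :: "nat \<Rightarrow> (letter list \<Rightarrow> letter list) set" where
  "nielsen_gens n = {tau n s t | s t. fst s < n \<and> fst t < n \<and> fst s \<noteq> fst t} \<union>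
    {sigma n s t | s t. fst s < n \<and> fst t < n \<and> s \<noteq> t}"

lemma tau_mem_gens: "fst s < n \<Longrightarrow> fst t < n \<Longrightarrow> fst s \<noteq> fst t \<Longrightarrow> tau n s t \<in> nielsen_gens n"
  and sigma_mem_gens: "fst s < n \<Longrightarrow> fst t < n \<Longrightarrow> s \<noteq> t \<Longrightarrow> sigma n s t \<in> nielsen_gens n"
  unfolding nielsen_gens_def by blast+

lemma nielsen_gens_auto: "nielsen_gens n \<subseteq> carrier (AutoGroup (free_group n))"
  by (auto simp: nielsen_gens_def AutoGroup_simps tau_auto sigma_auto)

text \<open>Induction on the number of moved generators: if \<open>s\<close> goes to
  \<open>t\<close>, following with \<open>sigma n s t\<close> fixes \<open>s\<close> and disturbs no
  generator fixed before.\<close>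

lemma signed_permutation_generated:
  assumes "\<psi> \<in> auto (free_group n)" "\<And>x. fst x < n \<Longrightarrow> \<exists>y. \<psi> [x] = [y]"
  shows "\<psi> \<in> generate (AutoGroup (free_group n)) (nielsen_gens n)"
  using assms
proof (induction "card {i. i < n \<and> \<psi> (gen i) \<noteq> gen i}" arbitrary: \<psi> rule: less_induct)
  case less
  note \<psi> = less.prems(1)
  note lm = letter_mapD[OF auto_letter_map[OF \<psi>]]
  interpret A: group "AutoGroup (free_group n)"
    by (rule group.AutoGroup[OF free_group_group])
  show ?case
  proof (cases "\<forall>i<n. \<psi> (gen i) = gen i")
    case True
    have "\<psi> = \<one>\<^bsub>AutoGroup (free_group n)\<^esub>"
    proof (rule auto_extI[OF \<psi> auto_one_closed])
      fix x :: letter assume x: "fst x < n"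
      have g: "\<psi> (gen (fst x)) = gen (fst x)" using True x by blast
      have "\<psi> [x] = [x]"
      proof (cases "snd x")
        case True
        then show ?thesis using g by (cases x) simp
      next
        case False
        then have "x = letter_inv (fst x, True)" by (cases x) (simp add: letter_inv_def)
        then show ?thesis using g lm(2)[of "(fst x, True)"] x by simp
      qed
      then show "\<psi> [x] = \<one>\<^bsub>AutoGroup (free_group n)\<^esub> [x]"
        using x by (simp add: auto_one_apply letter_carrier)
    qed
    then show ?thesis by (simp add: generate.one)
  next
    case False
    then obtain i where i: "i < n" "\<psi> (gen i) \<noteq> gen i" by blast
    define s where "s = (i, True)"
    have s: "fst s < n" "\<psi> [s] \<noteq> [s]" using i by (simp_all add: s_def)
    obtain t where t: "\<psi> [s] = [t]" using less.prems(2)[OF s(1)] by blast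
    have tn: "fst t < n" using lm(1)[OF s(1)] t by (simp add: letter_carrier)
    have st: "s \<noteq> t" using s t by auto
    define \<theta> where "\<theta> = sigma n s t \<otimes>\<^bsub>AutoGroup (free_group n)\<^esub> \<psi>"
    have sa: "sigma n s t \<in> auto (free_group n)" using s(1) tn st by (rule sigma_auto)
    have \<theta>: "\<theta> \<in> auto (free_group n)" unfolding \<theta>_def using sa \<psi> by (rule auto_mult_closed)
    have \<theta>_letter: "\<theta> [x] = [lswap s t y]" if "fst x < n" "\<psi> [x] = [y]" for x y
    proof -
      have "fst y < n" using lm(1)[OF that(1)] that(2) by (simp add: letter_carrier)
      then show ?thesis
        using that s(1) tn st by (simp add: \<theta>_def auto_mult_apply[OF sa \<psi>] letter_carrier sigma_letter)
    qed
    have "\<theta> [s] = [s]"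
      using \<theta>_letter[OF s(1) t] by (simp add: lswap_def)
    moreover have "\<theta> (gen k) = gen k" if k: "k < n" "\<psi> (gen k) = gen k" for k
    proof -
      have ne: "k \<noteq> i" using k i by auto
      \<comment> \<open>\<open>t\<close> and its inverse are already the images of \<open>s\<close>
        and its inverse, so by injectivity neither is the fixed generator \<open>k\<close>.\<close>
      have inj: "u = v" if "fst u < n" "fst v < n" "\<psi> [u] = \<psi> [v]" for u v
        using auto_inj[OF \<psi> _ _ that(3)] that(1,2) by (simp add: letter_carrier)
      have "(k, True) \<noteq> t"
        using inj[of "(k, True)" s] k t s(1) ne by (auto simp: s_def)
      moreover have "(k, True) \<noteq> letter_inv t"
        using inj[of "(k, True)" "letter_inv s"] k t s(1) ne lm(2)[OF s(1)] by (auto simp: s_def letter_inv_def)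
      moreover have "(k, True) \<noteq> s" "(k, True) \<noteq> letter_inv s"
        using ne by (auto simp: s_def letter_inv_def)
      ultimately have "lswap s t (k, True) = (k, True)"
        unfolding lswap_def by presburger
      then show ?thesis using \<theta>_letter[of "(k, True)"] k by simp
    qed
    ultimately have "{j. j < n \<and> \<theta> (gen j) \<noteq> gen j} \<subset> {j. j < n \<and> \<psi> (gen j) \<noteq> gen j}"
      using i unfolding s_def by blast
    then have "card {j. j < n \<and> \<theta> (gen j) \<noteq> gen j} < card {j. j < n \<and> \<psi> (gen j) \<noteq> gen j}"
      by (intro psubset_card_mono) auto
    moreover have "\<exists>y. \<theta> [x] = [y]" if "fst x < n" for x
      using \<theta>_letter[OF that] less.prems(2)[OF that] by blast
    ultimately have \<theta>_gen: "\<theta> \<in> generate (AutoGroup (free_group n)) (nielsen_gens n)"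
      using less.hyps \<theta> by blast
    have "sigma n s t \<in> generate (AutoGroup (free_group n)) (nielsen_gens n)"
      using s(1) tn st by (intro generate.incl sigma_mem_gens)
    then have "sigma n s t \<otimes>\<^bsub>AutoGroup (free_group n)\<^esub> \<theta> \<in> generate (AutoGroup (free_group n)) (nielsen_gens n)"
      using \<theta>_gen by (rule generate.eng)
    moreover have "sigma n s t \<otimes>\<^bsub>AutoGroup (free_group n)\<^esub> \<theta> = \<psi>"
      using sa \<psi> sigma_sigma[OF s(1) tn st] unfolding \<theta>_def
      by (simp add: AutoGroup_simps(1) flip: A.m_assoc)
    ultimately show ?thesis by simp
  qed
qed

section \<open>Descent by Nielsen moves\<close>

lemma sum_letters:
  fixes f :: "letter \<Rightarrow> nat"
  assumes "fst s < n"
  shows "(\<Sum>x\<in>{..<n} \<times> UNIV. f x) =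
    f s + f (letter_inv s) + (\<Sum>x\<in>{..<n} \<times> UNIV - {s, letter_inv s}. f x)"
proof -
  have "{s, letter_inv s} \<subseteq> {..<n} \<times> UNIV"
    using assms by (auto simp: mem_Times_iff)
  from sum.subset_diff[OF this, of f] show ?thesis by simp
qed

text \<open>Composing with a transvection on the right is a Nielsen move on the tuple of images:
  only the image of \<open>s\<close>, with its inverse, changes.\<close>

lemma auto_mult_tau_letter:
  assumes "\<phi> \<in> auto (free_group n)" "fst s < n" "fst t < n" "fst s \<noteq> fst t"
  shows "(\<phi> \<otimes>\<^bsub>AutoGroup (free_group n)\<^esub> tau n s t) [s] = \<phi> [s] \<star> \<phi> [t]"
    and "(\<phi> \<otimes>\<^bsub>AutoGroup (free_group n)\<^esub> tau n s t) [letter_inv s] = word_inv (\<phi> [s] \<star> \<phi> [t])"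
    and "x \<notin> {s, letter_inv s} \<Longrightarrow> fst x < n \<Longrightarrow>
      (\<phi> \<otimes>\<^bsub>AutoGroup (free_group n)\<^esub> tau n s t) [x] = \<phi> [x]"
proof -
  note tau = tau_auto[OF assms(2-4)] and lm = letter_map_transv[OF assms(2-4)]
  have ap: "(\<phi> \<otimes>\<^bsub>AutoGroup (free_group n)\<^esub> tau n s t) [x] = \<phi> (transv s t x)" if "fst x < n" for x
    using auto_mult_subst_aut_letter[OF assms(1) tau lm that] .
  have "[s, t] \<in> carrier (free_group n)"
    using transv_carrier[OF assms(2-4), of s] assms(2) by (simp add: transv_def)
  then have "\<phi> [s, t] = \<phi> [s] \<star> (\<phi> [t] \<star> [])"
    using auto_eq_subst_word[OF assms(1), of "[s, t]"] by simp
  then show 1: "(\<phi> \<otimes>\<^bsub>AutoGroup (free_group n)\<^esub> tau n s t) [s] = \<phi> [s] \<star> \<phi> [t]"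
    using ap[OF assms(2)] wmult_Nil_carrier[OF letter_mapD(1)[OF auto_letter_map[OF assms(1)] assms(3)]]
    by (simp add: transv_def)
  show "(\<phi> \<otimes>\<^bsub>AutoGroup (free_group n)\<^esub> tau n s t) [letter_inv s] = word_inv (\<phi> [s] \<star> \<phi> [t])"
    using letter_mapD(2)[OF auto_letter_map[OF auto_mult_closed[OF assms(1) tau]] assms(2)] 1 by simp
  show "(\<phi> \<otimes>\<^bsub>AutoGroup (free_group n)\<^esub> tau n s t) [x] = \<phi> [x]" if "x \<notin> {s, letter_inv s}" "fst x < n"
    using ap[OF that(2)] that(1) by (simp add: transv_def)
qed

definition total_length :: "nat \<Rightarrow> (letter list \<Rightarrow> letter list) \<Rightarrow> nat" where
  "total_length n \<phi> = (\<Sum>x\<in>{..<n} \<times> UNIV. length (\<phi> [x]))"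

text \<open>Summing over inverse letters as well measures both ends of each image, since the initial
  half of the inverse word is its inverted end.\<close>

definition total_rank :: "nat \<Rightarrow> (letter list \<Rightarrow> letter list) \<Rightarrow> nat" where
  "total_rank n \<phi> = (\<Sum>x\<in>{..<n} \<times> UNIV. rank n (half (\<phi> [x])))"

text \<open>Minimal length gives the first condition. If the second failed, multiplying the image of
  \<open>t\<close> on the left by that of \<open>s\<close> would keep the length and lower the
  rank.\<close>

lemma nielsen_reduced_if_minimal:
  assumes \<phi>: "\<phi> \<in> auto (free_group n)"
    and min: "\<And>s t. fst s < n \<Longrightarrow> fst t < n \<Longrightarrow> fst s \<noteq> fst t \<Longrightarrow>
      (\<phi> \<otimes>\<^bsub>AutoGroup (free_group n)\<^esub> tau n s t, \<phi>) \<notin> measures [total_length n, total_rank n]"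
  shows "nielsen_reduced n (\<lambda>x. \<phi> [x])"
proof -
  note lm = letter_mapD[OF auto_letter_map[OF \<phi>]]
  have len: "length (\<phi> [s]) \<le> length (\<phi> [s] \<star> \<phi> [t])"
    and rank: "length (\<phi> [s] \<star> \<phi> [t]) = length (\<phi> [s]) \<Longrightarrow>
      rank n (half (\<phi> [s])) + rank n (half (word_inv (\<phi> [s]))) \<le>
      rank n (half (\<phi> [s] \<star> \<phi> [t])) + rank n (half (word_inv (\<phi> [s] \<star> \<phi> [t])))"
    if st: "fst s < n" "fst t < n" "fst s \<noteq> fst t" for s t
  proof -
    let ?\<phi>' = "\<phi> \<otimes>\<^bsub>AutoGroup (free_group n)\<^esub> tau n s t"
    let ?R = "{..<n} \<times> UNIV - {s, letter_inv s}"
    note tl = auto_mult_tau_letter[OF \<phi> st]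
    have same: "(\<Sum>x\<in>?R. f (?\<phi>' [x])) = (\<Sum>x\<in>?R. f (\<phi> [x]))" for f :: "letter list \<Rightarrow> nat"
      using tl(3) by (intro sum.cong) auto
    have "total_length n ?\<phi>' = 2 * length (\<phi> [s] \<star> \<phi> [t]) + (\<Sum>x\<in>?R. length (\<phi> [x]))"
      "total_length n \<phi> = 2 * length (\<phi> [s]) + (\<Sum>x\<in>?R. length (\<phi> [x]))"
      unfolding total_length_def sum_letters[OF st(1)] same tl(1,2) lm(2)[OF st(1)] by simp_all
    moreover have "total_rank n ?\<phi>' = rank n (half (\<phi> [s] \<star> \<phi> [t])) + rank n (half (word_inv (\<phi> [s] \<star> \<phi> [t])))
        + (\<Sum>x\<in>?R. rank n (half (\<phi> [x])))"
      "total_rank n \<phi> = rank n (half (\<phi> [s])) + rank n (half (word_inv (\<phi> [s]))) + (\<Sum>x\<in>?R. rank n (half (\<phi> [x])))"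
      unfolding total_rank_def sum_letters[OF st(1)] same[of "\<lambda>w. rank n (half w)"] tl(1,2) lm(2)[OF st(1)]
      by simp_all
    ultimately show "length (\<phi> [s]) \<le> length (\<phi> [s] \<star> \<phi> [t])"
      and "length (\<phi> [s] \<star> \<phi> [t]) = length (\<phi> [s]) \<Longrightarrow>
      rank n (half (\<phi> [s])) + rank n (half (word_inv (\<phi> [s]))) \<le>
      rank n (half (\<phi> [s] \<star> \<phi> [t])) + rank n (half (word_inv (\<phi> [s] \<star> \<phi> [t])))"
      using min[OF st] by auto
  qed
  have "rank n q \<le> rank n p"
    if st: "fst s < n" "fst t < n" "fst s \<noteq> fst t" and U: "\<phi> [s] = p @ word_inv q" "\<phi> [t] = q @ b" "length p = length q"
    for s t p q b
  proof (rule ccontr)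
    assume less: "\<not> rank n q \<le> rank n p"
    let ?s = "letter_inv s" and ?t = "letter_inv t"
    \<comment> \<open>Left multiplication on \<open>t\<close> is right multiplication on
      \<open>?t\<close> by \<open>?s\<close>, which is the form of move covered by
      \<open>len\<close> and \<open>rank\<close>.\<close>
    have inv: "\<phi> [?t] \<star> \<phi> [?s] = word_inv (\<phi> [s] \<star> \<phi> [t])"
    proof -
      have "word_inv (\<phi> [s] \<star> \<phi> [t]) = inv\<^bsub>free_group n\<^esub> (\<phi> [s] \<otimes>\<^bsub>free_group n\<^esub> \<phi> [t])"
        using lm(1)[OF st(1)] lm(1)[OF st(2)] monoid.m_closed[OF group.is_monoid[OF free_group_group[of n]]]
        by (metis inv_free_group free_group_simps(2))
      also have "\<dots> = inv\<^bsub>free_group n\<^esub> \<phi> [t] \<otimes>\<^bsub>free_group n\<^esub> inv\<^bsub>free_group n\<^esub> \<phi> [s]"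
        using lm(1)[OF st(1)] lm(1)[OF st(2)] by (intro group.inv_mult_group[OF free_group_group])
      finally show ?thesis
        using lm(1)[OF st(1)] lm(1)[OF st(2)] lm(2)[OF st(1)] lm(2)[OF st(2)]
        by (simp add: inv_free_group free_group_simps(2))
    qed
    have pb: "\<phi> [s] \<star> \<phi> [t] = p \<star> b"
      using wmult_cancel[of p "word_inv q" b] U by simp
    have "length (\<phi> [t]) \<le> length (p \<star> b)"
      using len[of ?t ?s] st inv lm(2)[OF st(2)] pb by simp
    then have eq: "p \<star> b = p @ b"
      using U length_wmult_le[of p b] by (intro wmult_eq_append) simp
    have "length q \<le> length b"
      using len[OF st] pb eq U by simp
    then have "rank n (half (p @ b)) < rank n (half (q @ b))" "half (word_inv (p @ b)) = half (word_inv (q @ b))"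
      using less U(3) st(1) rank_half_less[of n p q b] by simp_all
    moreover have "rank n (half (word_inv (q @ b))) + rank n (half (q @ b)) \<le>
        rank n (half (word_inv (p @ b))) + rank n (half (p @ b))"
      using rank[of ?t ?s] st inv pb eq U(2,3) lm(2)[OF st(2)] by (simp del: rev_append map_append rev_map)
    ultimately show False by simp
  qed
  then show ?thesis
    using len unfolding nielsen_reduced_def by blast
qed

text \<open>Descent along the lexicographic order of total length and total rank. Where no move
  descends, \<open>\<phi>\<close> is Nielsen reduced and does not shorten words, so its inverse
  sends letters to letters and is a signed permutation.\<close>

theorem nielsen_generation:
  assumes "\<phi> \<in> auto (free_group n)"
  shows "\<phi> \<in> generate (AutoGroup (free_group n)) (nielsen_gens n)"
  using assms
proof (induction \<phi> rule: wf_induct_rule[OF wf_measures[of "[total_length n, total_rank n]"]])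
  case (1 \<phi>)
  let ?A = "AutoGroup (free_group n)"
  interpret A: group ?A by (rule group.AutoGroup[OF free_group_group])
  show ?case
  proof (cases "\<exists>s t. fst s < n \<and> fst t < n \<and> fst s \<noteq> fst t \<and>
      (\<phi> \<otimes>\<^bsub>?A\<^esub> tau n s t, \<phi>) \<in> measures [total_length n, total_rank n]")
    case True
    then obtain s t where st: "fst s < n" "fst t < n" "fst s \<noteq> fst t"
      and less: "(\<phi> \<otimes>\<^bsub>?A\<^esub> tau n s t, \<phi>) \<in> measures [total_length n, total_rank n]" by blast
    note tau = tau_auto[OF st]
    have gen: "\<phi> \<otimes>\<^bsub>?A\<^esub> tau n s t \<in> generate ?A (nielsen_gens n)"
      using 1(1)[OF less auto_mult_closed[OF 1(2) tau]] .
    have "tau n s (letter_inv t) \<in> generate ?A (nielsen_gens n)"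
      using st by (intro generate.incl tau_mem_gens) simp_all
    from generate.eng[OF gen this]
    have "\<phi> \<otimes>\<^bsub>?A\<^esub> tau n s t \<otimes>\<^bsub>?A\<^esub> tau n s (letter_inv t) \<in> generate ?A (nielsen_gens n)" .
    moreover have "\<phi> \<otimes>\<^bsub>?A\<^esub> tau n s t \<otimes>\<^bsub>?A\<^esub> tau n s (letter_inv t) = \<phi>"
      using 1(2) st tau tau_auto[of s n "letter_inv t"]
      by (simp add: A.m_assoc AutoGroup_simps(1) tau_tau_inv)
    ultimately show ?thesis by simp
  next
    case False
    then have red: "nielsen_reduced n (\<lambda>x. \<phi> [x])"
      using nielsen_reduced_if_minimal[OF 1(2)] by blast
    define \<psi> where "\<psi> = inv\<^bsub>?A\<^esub> \<phi>"
    have \<psi>: "\<psi> \<in> auto (free_group n)" "\<phi> \<otimes>\<^bsub>?A\<^esub> \<psi> = \<one>\<^bsub>?A\<^esub>"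
      using 1(2) A.inv_closed[of \<phi>] A.r_inv[of \<phi>] by (simp_all add: \<psi>_def AutoGroup_simps(1))
    have "\<exists>y. \<psi> [x] = [y]" if x: "fst x < n" for x
    proof -
      have xc: "[x] \<in> carrier (free_group n)" using x by (simp add: letter_carrier)
      have \<psi>x: "\<psi> [x] \<in> carrier (free_group n)"
        using letter_mapD(1)[OF auto_letter_map[OF \<psi>(1)] x] .
      have "\<phi> (\<psi> [x]) = [x]"
        using auto_mult_apply[OF 1(2) \<psi>(1) xc] \<psi>(2) auto_one_apply[OF xc] by simp
      then have "length (\<psi> [x]) \<le> 1"
        using nielsen_length_le[OF auto_letter_map[OF 1(2)] auto_letter_ne[OF 1(2)] red \<psi>x]
          auto_eq_subst_word[OF 1(2) \<psi>x] by simp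
      then show ?thesis
        using auto_letter_ne[OF \<psi>(1) x] by (cases "\<psi> [x]") auto
    qed
    then have "\<psi> \<in> generate ?A (nielsen_gens n)"
      using signed_permutation_generated[OF \<psi>(1)] by blast
    then have "inv\<^bsub>?A\<^esub> \<psi> \<in> generate ?A (nielsen_gens n)"
      using A.generate_m_inv_closed[OF nielsen_gens_auto] by blast
    then show ?thesis
      using 1(2) by (simp add: \<psi>_def AutoGroup_simps(1))
  qed
qed

section \<open>The action on the circle\<close>

lemma klein_collapsing_homeo_circle: "klein_collapsing (homeo_group circle)"
  unfolding klein_collapsing_def
proof (intro ballI impI)
  let ?H = "homeo_group circle"
  fix a b u v
  assume car: "a \<in> carrier ?H" "b \<in> carrier ?H" "u \<in> carrier ?H" "v \<in> carrier ?H"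
    and rel: "a \<otimes>\<^bsub>?H\<^esub> a = \<one>\<^bsub>?H\<^esub>" "b \<otimes>\<^bsub>?H\<^esub> b = \<one>\<^bsub>?H\<^esub>" "a \<otimes>\<^bsub>?H\<^esub> b = b \<otimes>\<^bsub>?H\<^esub> a"
      "u \<otimes>\<^bsub>?H\<^esub> a = b \<otimes>\<^bsub>?H\<^esub> u" "v \<otimes>\<^bsub>?H\<^esub> a = a \<otimes>\<^bsub>?H\<^esub> b \<otimes>\<^bsub>?H\<^esub> v"
  have bij: "f \<in> Bij circle" and maps: "f \<in> circle \<rightarrow> circle" and cont: "continuous_on circle f"
    if f: "f \<in> carrier ?H" for f
  proof -
    show "f \<in> Bij circle" using f by (simp add: homeo_group_def)
    then show "f \<in> circle \<rightarrow> circle" by (rule Bij_imp_funcset)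
    obtain g where "homeomorphism circle circle f g" using f by (auto simp: homeo_group_def)
    then show "continuous_on circle f" by (rule homeomorphism_cont1)
  qed
  have mult: "(f \<otimes>\<^bsub>?H\<^esub> g) x = f (g x)" if "f \<in> carrier ?H" "g \<in> carrier ?H" "x \<in> circle" for f g x
    using bij[OF that(1)] bij[OF that(2)] that(3) by (simp add: homeo_group_def BijGroup_def compose_eq)
  have one: "\<one>\<^bsub>?H\<^esub> x = x" if "x \<in> circle" for x
    using that by (simp add: homeo_group_def BijGroup_def)
  have closed: "a \<otimes>\<^bsub>?H\<^esub> b \<in> carrier ?H"
    using car group.is_monoid[OF group_homeo_group[of circle]] by (simp add: monoid.m_closed)
  have point: "a (a x) = x" "b (b x) = x" "a (b x) = b (a x)" "u (a x) = b (u x)" "v (a x) = a (b (v x))"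
    if x: "x \<in> circle" for x
  proof -
    note m = mult[OF _ _ x]
    show "a (a x) = x" "b (b x) = x" "a (b x) = b (a x)" "u (a x) = b (u x)"
      using rel(1-4)[THEN fun_cong, of x] x by (simp_all add: m car one)
    have "v x \<in> circle" using maps[OF car(4)] x by blast
    then show "v (a x) = a (b (v x))"
      using rel(5)[THEN fun_cong, of x] by (simp add: m car closed mult)
  qed
  have "a x = x" if "x \<in> circle" for x
  proof (rule klein_four_action_trivial[of circle a b u v])
    show "bij_betw u circle circle" "bij_betw v circle circle"
      using bij[OF car(3)] bij[OF car(4)] by (auto simp: Bij_def)
  qed (use car cont maps point circle_punctured_chart that in auto)
  moreover have "a \<in> extensional circle" "\<one>\<^bsub>?H\<^esub> \<in> extensional circle"
    using bij[OF car(1)] by (auto simp: Bij_def homeo_group_def BijGroup_def)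
  ultimately show "a = \<one>\<^bsub>?H\<^esub>"
    using one by (intro extensionalityI) auto
qed

text \<open>In an abelian group conjugate elements coincide, and \<open>a = b = ab\<close> forces
  \<open>a = 1\<close>.\<close>

lemma klein_collapsing_sign_img: "klein_collapsing sign_img"
  by (auto simp: klein_collapsing_def sign_img_def)

lemma aut_det_eps:
  assumes "i < n"
  shows "aut_det n (eps n i) = - 1"
proof -
  have "aut_matrix n (eps n i) = multrow_mat n i (- 1)"
  proof (rule eq_matI)
    fix k l assume "k < dim_row (multrow_mat n i (- 1 :: int))" "l < dim_col (multrow_mat n i (- 1 :: int))"
    then have kl: "k < n" "l < n" by auto
    then have "eps n i (gen l) = [lswap (i, True) (i, False) (l, True)]"
      using assms by (simp add: sigma_letter)
    then show "aut_matrix n (eps n i) $$ (k, l) = multrow_mat n i (- 1) $$ (k, l)"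
      using kl by (auto simp: aut_matrix_def abelianize_def lswap_eps exp_sum_Cons letter_inv_def)
  qed (simp_all add: aut_matrix_def)
  then show ?thesis
    using det_multrow_mat[OF assms] by (simp add: aut_det_def)
qed

theorem theoremE:
  fixes n :: nat and \<rho> :: "(letter list \<Rightarrow> letter list) \<Rightarrow> complex \<Rightarrow> complex"
  assumes "3 \<le> n"
    and "\<rho> \<in> hom (AutoGroup (free_group n)) (homeo_group circle)"
  shows "\<exists>\<sigma> \<in> hom sign_img (homeo_group circle).
    \<forall>\<phi> \<in> carrier (AutoGroup (free_group n)). \<rho> \<phi> = \<sigma> (aut_det n \<phi>)"
proof -
  let ?A = "AutoGroup (free_group n)" and ?H = "homeo_group circle"
  interpret A: group ?A by (rule group.AutoGroup[OF free_group_group])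
  interpret H: group ?H by (rule group_homeo_group)
  interpret r: group_hom ?A ?H \<rho>
    using assms(2) by (simp add: group_hom_def group_hom_axioms_def A.is_group H.is_group)
  interpret d: group_hom ?A sign_img "aut_det n"
    using aut_det_hom by (simp add: group_hom_def group_hom_axioms_def A.is_group sign_img_is_group)
  \<comment> \<open>The collapse lemmas are instantiated twice, for the action and for the
    determinant, so that their values on each generator can be compared.\<close>
  note rho = assms(2) H.is_group klein_collapsing_homeo_circle assms(1)
  note det = aut_det_hom[of n] sign_img_is_group klein_collapsing_sign_img assms(1)
  have n: "0 < n" using assms(1) by simp
  define e where "e = \<rho> (eps n 0)"
  have e: "e \<in> carrier ?H" "e \<otimes>\<^bsub>?H\<^esub> e = \<one>\<^bsub>?H\<^esub>"
    using hom_auto_closed[OF rho] hom_sigma_sigma[OF rho, of "(0, True)" "(0, False)"] n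
    by (simp_all add: e_def sigma_auto)
  \<comment> \<open>The element \<open>-1\<close> goes to the action \<open>e\<close> of an
    inversion, whose determinant is \<open>-1\<close>; since \<open>e\<close> squares to the
    identity, this is a homomorphism on \<open>sign_img\<close>.\<close>
  define \<sigma> where "\<sigma> x = (if x = 1 then \<one>\<^bsub>?H\<^esub> else e)" for x :: int
  have "\<sigma> \<in> hom sign_img ?H"
    using e by (auto simp: hom_def sign_img_def \<sigma>_def)
  note \<sigma> = group_hom.intro[OF sign_img_is_group H.is_group group_hom_axioms.intro[OF this]] this
  have gens: "\<rho> \<phi> = \<sigma> (aut_det n \<phi>)" if \<phi>: "\<phi> \<in> nielsen_gens n" for \<phi>
  proof -
    consider s t where "\<phi> = tau n s t" "fst s < n" "fst t < n" "fst s \<noteq> fst t"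
      | s t where "\<phi> = sigma n s t" "fst s < n" "fst t < n" "s \<noteq> t"
      using \<phi> unfolding nielsen_gens_def by blast
    then show ?thesis
    proof cases
      case 1
      then show ?thesis
        using collapse_tau[OF rho, of s t] collapse_tau[OF det, of s t] by (simp add: \<sigma>_def sign_img_def)
    next
      case 2
      then show ?thesis
        using collapse_sigma[OF rho, of s t 0] collapse_sigma[OF det, of s t 0] n by (simp add: \<sigma>_def e_def aut_det_eps)
    qed
  qed
  have "\<rho> \<phi> = \<sigma> (aut_det n \<phi>)" if "\<phi> \<in> generate ?A (nielsen_gens n)" for \<phi>
    using that
  proof (induction \<phi>)
    case one
    then show ?case
      using d.hom_one by (simp add: \<sigma>_def sign_img_def)
  next
    case (incl \<phi>)
    then show ?case by (rule gens)
  next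
    case (inv \<phi>)
    have \<phi>: "\<phi> \<in> carrier ?A" using inv nielsen_gens_auto by blast
    show ?case
      using gens[OF inv] r.hom_inv[OF \<phi>] d.hom_inv[OF \<phi>] group_hom.hom_inv[OF \<sigma>(1) d.hom_closed[OF \<phi>]]
      by simp
  next
    case (eng \<phi> \<psi>)
    have car: "\<phi> \<in> carrier ?A" "\<psi> \<in> carrier ?A"
      using eng.hyps A.generate_in_carrier[OF nielsen_gens_auto] by blast+
    then show ?case
      using eng.IH r.hom_mult[OF car] d.hom_mult[OF car] hom_mult[OF \<sigma>(2) d.hom_closed d.hom_closed, OF car]
      by simp
  qed
  then show ?thesis
    using \<sigma>(2) nielsen_generation[of _ n] by (auto simp: AutoGroup_simps(1))
qed

end
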